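(* Let $\pi:M\to\mathbb{R}$ be a smooth fibred manifold with $\dim M=n+1$, let $S$ be a semispray on $J^1\pi$, with induced horizontal projector $h$, Jacobi endomorphism $\Phi$ and dynamical covariant derivative $\nabla$. Let $\theta$ be a semi-basic $1$-form on $J^1\pi$ which is not $d_J$-closed (i.e. $d_J\theta\ne 0$). Then $\mathcal{L}_S\theta$ is a closed $1$-form if and only if all of the following conditions hold: $(H_1)$ $d_J\theta\wedge dt=0$; $(H_2)$ $d_h\theta\wedge dt=0$; $(H_3)$ $d_\Phi\theta\wedge dt=0$; $(H_4)$ $(\nabla d\theta)\wedge dt=0$; $(DS)$ the $1$-form $i_Sd\theta$ is a dual symmetry for $S$, i.e. $\mathcal{L}_S(i_Sd\theta)=0$.
   Context: Everything is $C^\infty$. $\pi:M\to\mathbb{R}$ is a fibred manifold (surjective submersion) with $\dim M=n+1$, $J^1\pi$ is the first jet bundle of local sections of $\pi$, and $\pi_{10}:J^1\pi\to M$. Fibred coordinates $(t,x^i)$ on $M$ ($t$ the global coordinate of $\mathbb{R}$) induce coordinates $(t,x^i,y^i)$ on $J^1\pi$. Put $\delta x^i=dx^i-y^i\,dt$. Vertical vectors are those in $\operatorname{Ker}D\pi_{10}$, spanned by $\partial/\partial y^i$. The vertical endomorphism is $J=\frac{\partial}{\partial y^i}\otimes\delta x^i$. A semispray is a globally defined vector field $S$ on $J^1\pi$ with $J(S)=0$ and $dt(S)=1$. A $1$-form is semi-basic if it vanishes on vertical vectors. For a $(1,1)$-tensor field $A$: $(\mathcal{L}_SA)(X)=[S,AX]-A[S,X]$.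 The semispray induces the horizontal projector $h=\frac12\left(\operatorname{Id}-\mathcal{L}_SJ+S\otimes dt\right)$, where $(S\otimes dt)(X)=dt(X)S$, the vertical projector $v=\operatorname{Id}-h$, and the Jacobi endomorphism $\Phi=v\circ\mathcal{L}_Sh$. For a $(1,1)$-tensor field $A$ and a $k$-form $\omega$: $i_A\omega(X_1,\dots,X_k)=\sum_{j}\omega(X_1,\dots,AX_j,\dots,X_k)$ (and $i_A\omega=0$ if $k=0$), and $d_A\omega=i_Ad\omega-d\,i_A\omega$. The dynamical covariant derivative $\nabla$ is the unique tensor derivation on $J^1\pi$ ($\mathbb{R}$-linear, type preserving, Leibniz rule for $\otimes$, commuting with contractions) with $\nabla f=S(f)$ on functions and $\nabla X=h[S,hX]+v[S,vX]$ on vector fields; on a $k$-form $\omega$ it is $(\nabla\omega)(X_1,\dots,X_k)=S(\omega(X_1,\dots,X_k))-\sum_j\omega(X_1,\dots,\nabla X_j,\dots,X_k)$. *)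

theory Defs
  imports "HOL-Analysis.Analysis"
begin

section \<open>Smooth maps between open subsets of normed spaces\<close>

primrec Ck_on :: "nat \<Rightarrow> 'a::real_normed_vector set \<Rightarrow> ('a \<Rightarrow> 'b::real_normed_vector) \<Rightarrow> bool" where
  "Ck_on 0 U f \<longleftrightarrow> continuous_on U f"
| "Ck_on (Suc k) U f \<longleftrightarrow>
     (\<forall>x\<in>U. f differentiable (at x)) \<and>
     (\<forall>v. Ck_on k U (\<lambda>x. frechet_derivative f (at x) v))"

text \<open>Meant for open \<open>U\<close> in a finite-dimensional space, where control of every directional
  derivative suffices.\<close>
definition smooth_on :: "'a::real_normed_vector set \<Rightarrow> ('a \<Rightarrow> 'b::real_normed_vector) \<Rightarrow> bool" where
  "smooth_on U f \<longleftrightarrow> (\<forall>k. Ck_on k U f)"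


section \<open>Smooth manifolds\<close>

text \<open>A chart is a domain with a coordinate map; the map is only relevant on the domain.\<close>
type_synonym ('p, 'e) chart = "'p set \<times> ('p \<Rightarrow> 'e)"

abbreviation chart_image :: "('p, 'e) chart \<Rightarrow> 'e set" where
  "chart_image c \<equiv> snd c ` fst c"

abbreviation chart_inv :: "('p, 'e) chart \<Rightarrow> 'e \<Rightarrow> 'p" where
  "chart_inv c \<equiv> inv_into (fst c) (snd c)"

abbreviation transition :: "('p, 'e) chart \<Rightarrow> ('p, 'e) chart \<Rightarrow> 'e \<Rightarrow> 'e" where
  "transition c d \<equiv> snd d \<circ> chart_inv c"

definition coordinate_chart :: "'p topology \<Rightarrow> ('p, 'e::euclidean_space) chart \<Rightarrow> bool" where
  "coordinate_chart T c \<longleftrightarrow>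
     openin T (fst c) \<and> open (chart_image c) \<and>
     homeomorphic_map (subtopology T (fst c)) (top_of_set (chart_image c)) (snd c)"

definition smoothly_compatible ::
    "('p, 'e::euclidean_space) chart \<Rightarrow> ('p, 'e) chart \<Rightarrow> bool" where
  "smoothly_compatible c d \<longleftrightarrow>
     smooth_on (snd c ` (fst c \<inter> fst d)) (transition c d) \<and>
     smooth_on (snd d ` (fst c \<inter> fst d)) (transition d c)"

text \<open>The last clause makes the atlas maximal.\<close>
definition smooth_manifold :: "'p topology \<Rightarrow> ('p, 'e::euclidean_space) chart set \<Rightarrow> bool" where
  "smooth_manifold T A \<longleftrightarrow>
     Hausdorff_space T \<and> second_countable T \<and>
     (\<Union>c\<in>A. fst c) = topspace T \<and>
     (\<forall>c\<in>A. coordinate_chart T c) \<and>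
     (\<forall>c\<in>A. \<forall>d\<in>A. smoothly_compatible c d) \<and>
     (\<forall>c. coordinate_chart T c \<and> (\<forall>d\<in>A. smoothly_compatible c d) \<longrightarrow> c \<in> A)"


section \<open>Fibred manifolds over the real line and their first jet bundles\<close>

definition fibred_manifold ::
    "'p topology \<Rightarrow> ('p, real \<times> (real^'n)) chart set \<Rightarrow> ('p \<Rightarrow> real) \<Rightarrow> bool" where
  "fibred_manifold T A \<pi> \<longleftrightarrow>
     smooth_manifold T A \<and>
     \<pi> ` topspace T = UNIV \<and>
     (\<forall>c\<in>A. smooth_on (chart_image c) (\<pi> \<circ> chart_inv c)) \<and>
     (\<forall>c\<in>A. \<forall>x\<in>chart_image c. surj (frechet_derivative (\<pi> \<circ> chart_inv c) (at x)))"

text \<open>Fibred coordinates \<open>(t, x\<^sup>i)\<close>: the first coordinate is the projection to the base.\<close>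
definition fibred_charts ::
    "('p, real \<times> (real^'n)) chart set \<Rightarrow> ('p \<Rightarrow> real) \<Rightarrow> ('p, real \<times> (real^'n)) chart set" where
  "fibred_charts A \<pi> = {c \<in> A. \<forall>p\<in>fst c. fst (snd c p) = \<pi> p}"

definition smooth_curve_on ::
    "('p, 'e::euclidean_space) chart set \<Rightarrow> real set \<Rightarrow> (real \<Rightarrow> 'p) \<Rightarrow> bool" where
  "smooth_curve_on A I \<gamma> \<longleftrightarrow>
     \<gamma> ` I \<subseteq> (\<Union>c\<in>A. fst c) \<and>
     (\<forall>c\<in>A. open {s\<in>I. \<gamma> s \<in> fst c} \<and> smooth_on {s\<in>I. \<gamma> s \<in> fst c} (snd c \<circ> \<gamma>))"

definition local_section_at ::
    "('p, real \<times> (real^'n)) chart set \<Rightarrow> ('p \<Rightarrow> real) \<Rightarrow> real \<Rightarrow> (real \<Rightarrow> 'p) \<Rightarrow> bool" where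
  "local_section_at A \<pi> t \<gamma> \<longleftrightarrow>
     (\<exists>I. open I \<and> t \<in> I \<and> smooth_curve_on A I \<gamma> \<and> (\<forall>s\<in>I. \<pi> (\<gamma> s) = s))"

text \<open>A 1-jet is its source together with a class of local sections having first-order contact
  there.\<close>
type_synonym 'p jet = "real \<times> (real \<Rightarrow> 'p) set"

definition jet1 ::
    "('p, real \<times> (real^'n)) chart set \<Rightarrow> ('p \<Rightarrow> real) \<Rightarrow> (real \<Rightarrow> 'p) \<Rightarrow> real \<Rightarrow> 'p jet" where
  "jet1 A \<pi> \<gamma> t =
     (t, {\<sigma>. local_section_at A \<pi> t \<sigma> \<and> \<sigma> t = \<gamma> t \<and>
             (\<forall>c\<in>A. \<gamma> t \<in> fst c \<longrightarrow>
                vector_derivative (snd c \<circ> \<sigma>) (at t) = vector_derivative (snd c \<circ> \<gamma>) (at t))})"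

definition jet_space :: "('p, real \<times> (real^'n)) chart set \<Rightarrow> ('p \<Rightarrow> real) \<Rightarrow> 'p jet set" where
  "jet_space A \<pi> = {jet1 A \<pi> \<gamma> t | \<gamma> t. local_section_at A \<pi> t \<gamma>}"

abbreviation jet_representative :: "'p jet \<Rightarrow> real \<Rightarrow> 'p" where
  "jet_representative j \<equiv> SOME \<gamma>. \<gamma> \<in> snd j"

definition jet_proj :: "'p jet \<Rightarrow> 'p" where
  "jet_proj j = jet_representative j (fst j)"

text \<open>Model space of the jet bundle: coordinates \<open>(t, x\<^sup>i, y\<^sup>i)\<close>.\<close>
type_synonym 'n jet_model = "real \<times> (real^'n) \<times> (real^'n)"

text \<open>The coordinates \<open>(t, x\<^sup>i, y\<^sup>i)\<close> induced by fibred coordinates \<open>(t, x\<^sup>i)\<close>: the \<open>y\<^sup>i\<close> are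
  the velocities \<open>(x\<^sup>i \<circ> \<gamma>)'(t)\<close>.\<close>
definition jet_chart ::
    "('p, real \<times> (real^'n)) chart set \<Rightarrow> ('p \<Rightarrow> real) \<Rightarrow>
     ('p, real \<times> (real^'n)) chart \<Rightarrow> ('p jet, 'n jet_model) chart" where
  "jet_chart A \<pi> c =
     ({j \<in> jet_space A \<pi>. jet_proj j \<in> fst c},
      \<lambda>j. (fst j, snd (snd c (jet_proj j)),
           snd (vector_derivative (snd c \<circ> jet_representative j) (at (fst j)))))"

definition jet_atlas ::
    "('p, real \<times> (real^'n)) chart set \<Rightarrow> ('p \<Rightarrow> real) \<Rightarrow> ('p jet, 'n jet_model) chart set" where
  "jet_atlas A \<pi> = jet_chart A \<pi> ` fibred_charts A \<pi>"


section \<open>Tensor fields\<close>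

text \<open>
  A tensor field on the manifold with atlas \<open>B\<close> is given by its local representatives, one for
  each chart of \<open>B\<close>, related by the derivatives of the transition maps. The representative in a
  chart \<open>c\<close> matters only on \<open>chart_image c\<close>. A \<open>k\<close>-form takes the list of its \<open>k\<close> arguments; its
  values on lists of other lengths are irrelevant.\<close>

type_synonym ('p, 'e) vfield = "('p, 'e) chart \<Rightarrow> 'e \<Rightarrow> 'e"
type_synonym ('p, 'e) endo = "('p, 'e) chart \<Rightarrow> 'e \<Rightarrow> 'e \<Rightarrow> 'e"
type_synonym ('p, 'e) form = "('p, 'e) chart \<Rightarrow> 'e \<Rightarrow> 'e list \<Rightarrow> real"

definition vector_field ::
    "('p, 'e::euclidean_space) chart set \<Rightarrow> ('p, 'e) vfield \<Rightarrow> bool" where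
  "vector_field B X \<longleftrightarrow>
     (\<forall>c\<in>B. smooth_on (chart_image c) (X c)) \<and>
     (\<forall>c\<in>B. \<forall>d\<in>B. \<forall>p\<in>fst c \<inter> fst d.
        X d (snd d p) = frechet_derivative (transition c d) (at (snd c p)) (X c (snd c p)))"

definition diff_form ::
    "('p, 'e::euclidean_space) chart set \<Rightarrow> nat \<Rightarrow> ('p, 'e) form \<Rightarrow> bool" where
  "diff_form B k \<omega> \<longleftrightarrow>
     (\<forall>c\<in>B. \<forall>vs. length vs = k \<longrightarrow>
        smooth_on (chart_image c) (\<lambda>x. \<omega> c x vs) \<and>
        (\<forall>x\<in>chart_image c.
           (\<forall>i<k. linear (\<lambda>v. \<omega> c x (vs[i := v]))) \<and>
           (\<forall>i<k. \<forall>j<k. i \<noteq> j \<and> vs ! i = vs ! j \<longrightarrow> \<omega> c x vs = 0))) \<and>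
     (\<forall>c\<in>B. \<forall>d\<in>B. \<forall>p\<in>fst c \<inter> fst d. \<forall>vs. length vs = k \<longrightarrow>
        \<omega> c (snd c p) vs =
        \<omega> d (snd d p) (map (frechet_derivative (transition c d) (at (snd c p))) vs))"

definition form_eq_0 ::
    "('p, 'e::euclidean_space) chart set \<Rightarrow> nat \<Rightarrow> ('p, 'e) form \<Rightarrow> bool" where
  "form_eq_0 B k \<omega> \<longleftrightarrow>
     (\<forall>c\<in>B. \<forall>x\<in>chart_image c. \<forall>vs. length vs = k \<longrightarrow> \<omega> c x vs = 0)"

text \<open>
  Below, a tensor field defined through its action on vector fields is evaluated at a vector \<open>v\<close> by
  inserting, in each chart separately, the constant local field \<open>\<lambda>_ _. v\<close>. Tensoriality makes the
  choice of the extension of \<open>v\<close> irrelevant; constant fields in the same chart commute.\<close>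

definition lie_bracket ::
    "('p, 'e::euclidean_space) vfield \<Rightarrow> ('p, 'e) vfield \<Rightarrow> ('p, 'e) vfield" where
  "lie_bracket X Y c x =
     frechet_derivative (Y c) (at x) (X c x) - frechet_derivative (X c) (at x) (Y c x)"

definition apply_endo ::
    "('p, 'e::euclidean_space) endo \<Rightarrow> ('p, 'e) vfield \<Rightarrow> ('p, 'e) vfield" where
  "apply_endo A X c x = A c x (X c x)"

definition lie_endo ::
    "('p, 'e::euclidean_space) vfield \<Rightarrow> ('p, 'e) endo \<Rightarrow> ('p, 'e) endo" where
  "lie_endo S A c x v =
     lie_bracket S (apply_endo A (\<lambda>_ _. v)) c x - A c x (lie_bracket S (\<lambda>_ _. v) c x)"

definition lie_form ::
    "('p, 'e::euclidean_space) vfield \<Rightarrow> ('p, 'e) form \<Rightarrow> ('p, 'e) form" where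
  "lie_form S \<omega> c x vs =
     frechet_derivative (\<lambda>z. \<omega> c z vs) (at x) (S c x) -
     (\<Sum>j<length vs. \<omega> c x (vs[j := lie_bracket S (\<lambda>_ _. vs ! j) c x]))"

text \<open>On constant local fields all bracket terms of the invariant formula for the exterior
  derivative vanish.\<close>
definition ext_d :: "('p, 'e::euclidean_space) form \<Rightarrow> ('p, 'e) form" where
  "ext_d \<omega> c x vs =
     (\<Sum>i<length vs. (- 1) ^ i *
        frechet_derivative (\<lambda>z. \<omega> c z (take i vs @ drop (Suc i) vs)) (at x) (vs ! i))"

definition interior_prod ::
    "('p, 'e::euclidean_space) vfield \<Rightarrow> ('p, 'e) form \<Rightarrow> ('p, 'e) form" where
  "interior_prod X \<omega> c x vs = \<omega> c x (X c x # vs)"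

definition i_endo ::
    "('p, 'e::euclidean_space) endo \<Rightarrow> ('p, 'e) form \<Rightarrow> ('p, 'e) form" where
  "i_endo A \<omega> c x vs = (\<Sum>j<length vs. \<omega> c x (vs[j := A c x (vs ! j)]))"

definition d_endo ::
    "('p, 'e::euclidean_space) endo \<Rightarrow> ('p, 'e) form \<Rightarrow> ('p, 'e) form" where
  "d_endo A \<omega> c x vs = i_endo A (ext_d \<omega>) c x vs - ext_d (i_endo A \<omega>) c x vs"

text \<open>\<open>\<alpha> \<and> \<beta>\<close> for a \<open>k\<close>-form \<open>\<alpha>\<close> and a 1-form \<open>\<beta>\<close>, where \<open>length vs = k + 1\<close>.\<close>
definition wedge1 ::
    "('p, 'e::euclidean_space) form \<Rightarrow> ('p, 'e) form \<Rightarrow> ('p, 'e) form" where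
  "wedge1 \<alpha> \<beta> c x vs =
     (\<Sum>i<length vs. (- 1) ^ (length vs - 1 - i) *
        \<alpha> c x (take i vs @ drop (Suc i) vs) * \<beta> c x [vs ! i])"


section \<open>Geometry of the first jet bundle\<close>

text \<open>The kernel of the derivative of \<open>jet_proj\<close> at the point with coordinates \<open>x\<close> in the jet
  chart \<open>d\<close>; \<open>A\<close> is the atlas of the target \<open>M\<close>.\<close>
definition vertical ::
    "('p, real \<times> (real^'n)) chart set \<Rightarrow> ('p jet, 'n jet_model) chart \<Rightarrow>
     'n jet_model \<Rightarrow> 'n jet_model \<Rightarrow> bool" where
  "vertical A d x v \<longleftrightarrow>
     (\<forall>c\<in>A. jet_proj (chart_inv d x) \<in> fst c \<longrightarrow>
        frechet_derivative (snd c \<circ> jet_proj \<circ> chart_inv d) (at x) v = 0)"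

definition semi_basic_1form ::
    "('p, real \<times> (real^'n)) chart set \<Rightarrow> ('p \<Rightarrow> real) \<Rightarrow> ('p jet, 'n jet_model) form \<Rightarrow> bool" where
  "semi_basic_1form A \<pi> \<theta> \<longleftrightarrow>
     diff_form (jet_atlas A \<pi>) 1 \<theta> \<and>
     (\<forall>d\<in>jet_atlas A \<pi>. \<forall>x\<in>chart_image d. \<forall>v. vertical A d x v \<longrightarrow> \<theta> d x [v] = 0)"

text \<open>The first coordinate of every induced chart is the global coordinate \<open>t\<close>.\<close>
definition dt :: "('p jet, 'n::finite jet_model) form" where
  "dt c x vs = fst (hd vs)"

text \<open>\<open>J = \<partial>/\<partial>y\<^sup>i \<otimes> (dx\<^sup>i - y\<^sup>i dt)\<close> in every induced chart.\<close>
definition vert_endo :: "('p jet, 'n::finite jet_model) endo" where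
  "vert_endo c = (\<lambda>(t, x, y) (a, b, w). (0, 0, b - a *\<^sub>R y))"

definition semispray ::
    "('p, real \<times> (real^'n)) chart set \<Rightarrow> ('p \<Rightarrow> real) \<Rightarrow> ('p jet, 'n jet_model) vfield \<Rightarrow> bool" where
  "semispray A \<pi> S \<longleftrightarrow>
     vector_field (jet_atlas A \<pi>) S \<and>
     (\<forall>c\<in>jet_atlas A \<pi>. \<forall>x\<in>chart_image c.
        vert_endo c x (S c x) = 0 \<and> dt c x [S c x] = 1)"

definition hor_proj :: "('p jet, 'n::finite jet_model) vfield \<Rightarrow> ('p jet, 'n::finite jet_model) endo" where
  "hor_proj S c x v = (1/2) *\<^sub>R (v - lie_endo S vert_endo c x v + dt c x [v] *\<^sub>R S c x)"

definition vert_proj :: "('p jet, 'n::finite jet_model) vfield \<Rightarrow> ('p jet, 'n::finite jet_model) endo" where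
  "vert_proj S c x v = v - hor_proj S c x v"

definition jacobi_endo :: "('p jet, 'n::finite jet_model) vfield \<Rightarrow> ('p jet, 'n::finite jet_model) endo" where
  "jacobi_endo S c x v = vert_proj S c x (lie_endo S (hor_proj S) c x v)"

definition nabla_vfield ::
    "('p jet, 'n::finite jet_model) vfield \<Rightarrow> ('p jet, 'n::finite jet_model) vfield \<Rightarrow>
     ('p jet, 'n::finite jet_model) vfield" where
  "nabla_vfield S X c x =
     hor_proj S c x (lie_bracket S (apply_endo (hor_proj S) X) c x) +
     vert_proj S c x (lie_bracket S (apply_endo (vert_proj S) X) c x)"

definition nabla_form ::
    "('p jet, 'n::finite jet_model) vfield \<Rightarrow> ('p jet, 'n::finite jet_model) form \<Rightarrow>
     ('p jet, 'n::finite jet_model) form" where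
  "nabla_form S \<omega> c x vs =
     frechet_derivative (\<lambda>z. \<omega> c z vs) (at x) (S c x) -
     (\<Sum>j<length vs. \<omega> c x (vs[j := nabla_vfield S (\<lambda>_ _. vs ! j) c x]))"

end

theory Submission
  imports Defs
begin

text \<open>
  All the conditions are local, so the theorem reduces to an equivalence on the image \<open>U\<close> of one
  jet chart, an open set where \<open>S = (1, y, f)\<close> and \<open>\<theta>\<close> kills \<open>(0, 0, b)\<close>. Put \<open>\<omega> = d\<theta>\<close> and let
  \<open>H a = h(0, a, 0)\<close> and \<open>V a = (0, 0, a)\<close>, which span \<open>ker dt\<close>; semi-basicness gives \<open>\<omega>(V, V) = 0\<close>.
  Since \<open>d\<L>\<^sub>S\<theta> = \<L>\<^sub>S\<omega>\<close> and \<open>\<L>\<^sub>S(i\<^sub>S\<omega>) = i\<^sub>S\<L>\<^sub>S\<omega>\<close>, closedness means that (DS) holds and \<open>\<L>\<^sub>S\<omega>\<close>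
  vanishes on \<open>ker dt\<close>. Comparing \<open>\<L>\<^sub>S\<close> with \<open>\<nabla>\<close> on \<open>ker dt\<close>,
  \<open>\<L>\<^sub>S\<omega>(H a, H b) = \<nabla>\<omega>(H a, H b) - i\<^sub>\<Phi>\<omega>(H a, H b)\<close>,
  \<open>\<L>\<^sub>S\<omega>(H a, V b) = \<nabla>\<omega>(H a, V b) + \<omega>(H a, H b)\<close> and
  \<open>\<L>\<^sub>S\<omega>(V a, V b) = \<omega>(H a, V b) - \<omega>(H b, V a)\<close>,
  whereas (H1) is the symmetry of \<open>\<omega>(H a, V b)\<close>, (H2) is \<open>\<omega>(H a, H b) = 0\<close>, (H3) is
  \<open>i\<^sub>\<Phi>\<omega>(H a, H b) = 0\<close> and (H4) is \<open>\<nabla>\<omega> = 0\<close> on \<open>ker dt\<close>. If \<open>\<L>\<^sub>S\<omega> = 0\<close>, the third identity gives (H1);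
  as \<open>\<nabla>\<close> preserves this symmetry, the second one splits into a symmetric and a skew part, both zero,
  which gives (H2); finally \<open>\<nabla>\<close> preserves (H2), and the first one gives the rest.\<close>

section \<open>Symmetry of second derivatives\<close>

lemma frechet_derivative_eq:
  "(f has_derivative f') (at x) \<Longrightarrow> frechet_derivative f (at x) v = f' v"
  by (drule frechet_derivative_at) simp

text \<open>Derivatives at a point of an open set depend only on the function near that point. The
  induction varies both functions because its step passes to their directional derivatives.\<close>

lemma Ck_on_cong:
  assumes "open U" "\<And>x. x \<in> U \<Longrightarrow> f x = g x" "Ck_on k U f"
  shows "Ck_on k U g"
  using assms(2,3)
proof (induction k arbitrary: f g)
  case 0
  then show ?case
    by (metis Ck_on.simps(1) continuous_on_cong)
next
  case (Suc k)
  have D: "(g has_derivative frechet_derivative f (at x)) (at x)" if "x \<in> U" for x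
  proof (rule has_derivative_transform_within_open[OF _ \<open>open U\<close> that])
    show "(f has_derivative frechet_derivative f (at x)) (at x)"
      using Suc.prems(2) that by (simp add: frechet_derivative_works[symmetric])
  qed (use Suc.prems(1) in blast)
  have "frechet_derivative f (at x) = frechet_derivative g (at x)" if "x \<in> U" for x
    using frechet_derivative_at[OF D[OF that]] .
  then have "Ck_on k U (\<lambda>x. frechet_derivative g (at x) v)" for v
    using Suc.prems(2)
    by (intro Suc.IH[of "\<lambda>x. frechet_derivative f (at x) v" "\<lambda>x. frechet_derivative g (at x) v"]) auto
  moreover have "g differentiable (at x)" if "x \<in> U" for x
    using D[OF that] unfolding differentiable_def by blast
  ultimately show ?case by simp
qed

lemma smooth_on_differentiable: "smooth_on U f \<Longrightarrow> x \<in> U \<Longrightarrow> f differentiable (at x)"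
  unfolding smooth_on_def using Ck_on.simps(2)[of 0 U f] by blast

lemma smooth_on_frechet_derivative:
  "smooth_on U f \<Longrightarrow> smooth_on U (\<lambda>x. frechet_derivative f (at x) v)"
  unfolding smooth_on_def using Ck_on.simps(2)[of _ U f] by blast

text \<open>This takes the place of a general chain rule: the derivative of a restriction to a line
  is the restriction of a directional derivative of \<open>f\<close>, so the induction stays within
  the same shape.\<close>

lemma Ck_on_compose_line:
  fixes f :: "'a::real_normed_vector \<Rightarrow> 'b::real_normed_vector"
  assumes "open I" "\<And>s. s \<in> I \<Longrightarrow> a + s *\<^sub>R v \<in> U" "Ck_on k U f"
  shows "Ck_on k I (\<lambda>s. f (a + s *\<^sub>R v))"
  using assms(3)
proof (induction k arbitrary: f)
  case 0
  moreover have "continuous_on I (\<lambda>s. a + s *\<^sub>R v)"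
    by (intro continuous_intros)
  ultimately show ?case
    using assms(2) continuous_on_compose2[of U f I "\<lambda>s. a + s *\<^sub>R v"] by auto
next
  case (Suc k)
  have D: "((\<lambda>s. f (a + s *\<^sub>R v)) has_derivative (\<lambda>r. frechet_derivative f (at (a + s *\<^sub>R v)) (r *\<^sub>R v))) (at s)"
    if "s \<in> I" for s
  proof -
    have "(f has_derivative frechet_derivative f (at (a + s *\<^sub>R v))) (at (a + s *\<^sub>R v))"
      using Suc.prems assms(2)[OF that] by (auto simp: frechet_derivative_works)
    moreover have "((\<lambda>s. a + s *\<^sub>R v) has_derivative (\<lambda>r. r *\<^sub>R v)) (at s)"
      by (auto intro!: derivative_eq_intros)
    ultimately show ?thesis
      by (rule has_derivative_compose[rotated])
  qed
  have "Ck_on k I (\<lambda>s. frechet_derivative (\<lambda>s. f (a + s *\<^sub>R v)) (at s) r)" for r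
  proof (rule Ck_on_cong[OF assms(1)])
    show "Ck_on k I (\<lambda>s. frechet_derivative f (at (a + s *\<^sub>R v)) (r *\<^sub>R v))"
      using Suc.prems Suc.IH[of "\<lambda>x. frechet_derivative f (at x) (r *\<^sub>R v)"] by simp
  next
    show "frechet_derivative f (at (a + s *\<^sub>R v)) (r *\<^sub>R v) = frechet_derivative (\<lambda>s. f (a + s *\<^sub>R v)) (at s) r"
      if "s \<in> I" for s
      by (rule frechet_derivative_eq[OF D[OF that], symmetric])
  qed
  moreover have "(\<lambda>s. f (a + s *\<^sub>R v)) differentiable (at x)" if "x \<in> I" for x
    using D[OF that] unfolding differentiable_def by blast
  ultimately show ?case by simp
qed

text \<open>Product rule for a pairing that is linear in one slot. Expanding \<open>W z\<close> in
  \<open>Basis\<close> leaves a finite sum of products, so differentiability of \<open>g z w\<close>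
  for each fixed \<open>w\<close> suffices.\<close>

lemma has_derivative_linear_apply:
  fixes g :: "'a::real_normed_vector \<Rightarrow> 'e::euclidean_space \<Rightarrow> 'b::real_normed_vector"
  assumes "open U" "x \<in> U" and lin: "\<And>z. z \<in> U \<Longrightarrow> linear (g z)"
    and g: "\<And>w. (\<lambda>z. g z w) differentiable (at x)" and W: "W differentiable (at x)"
  shows "((\<lambda>z. g z (W z)) has_derivative
      (\<lambda>u. frechet_derivative (\<lambda>z. g z (W x)) (at x) u + g x (frechet_derivative W (at x) u))) (at x)"
proof -
  define g' where "g' w = frechet_derivative (\<lambda>z. g z w) (at x)" for w
  define W' where "W' = frechet_derivative W (at x)"
  have gd: "((\<lambda>z. g z w) has_derivative g' w) (at x)" for w
    using g by (simp add: g'_def frechet_derivative_works)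
  have Wd: "(W has_derivative W') (at x)"
    using W by (simp add: W'_def frechet_derivative_works)
  have expand: "g z w = (\<Sum>b\<in>Basis. (w \<bullet> b) *\<^sub>R g z b)" if "z \<in> U" for z w
  proof -
    have "g z w = g z (\<Sum>b\<in>Basis. (w \<bullet> b) *\<^sub>R b)"
      by (simp add: euclidean_representation)
    then show ?thesis
      using lin[OF that] by (simp add: linear_sum linear_scale)
  qed
  have S: "((\<lambda>z. \<Sum>b\<in>Basis. (W z \<bullet> b) *\<^sub>R g z b) has_derivative
      (\<lambda>u. \<Sum>b\<in>Basis. (W x \<bullet> b) *\<^sub>R g' b u + (W' u \<bullet> b) *\<^sub>R g x b)) (at x)"
    by (auto intro!: derivative_eq_intros gd Wd)
  have T: "((\<lambda>z. \<Sum>b\<in>Basis. (W x \<bullet> b) *\<^sub>R g z b) has_derivative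
      (\<lambda>u. \<Sum>b\<in>Basis. (W x \<bullet> b) *\<^sub>R g' b u)) (at x)"
    by (auto intro!: derivative_eq_intros gd)
  have "((\<lambda>z. g z (W x)) has_derivative (\<lambda>u. \<Sum>b\<in>Basis. (W x \<bullet> b) *\<^sub>R g' b u)) (at x)"
    by (rule has_derivative_transform_within_open[OF T assms(1,2)]) (simp add: expand[of _ "W x"])
  \<comment> \<open>The sum of the coefficient derivatives is recognised as the derivative with
    \<open>W x\<close> frozen, by uniqueness of derivatives.\<close>
  then have "g' (W x) = (\<lambda>u. \<Sum>b\<in>Basis. (W x \<bullet> b) *\<^sub>R g' b u)"
    using gd has_derivative_unique by blast
  moreover have "((\<lambda>z. g z (W z)) has_derivative
      (\<lambda>u. \<Sum>b\<in>Basis. (W x \<bullet> b) *\<^sub>R g' b u + (W' u \<bullet> b) *\<^sub>R g x b)) (at x)"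
    by (rule has_derivative_transform_within_open[OF S assms(1,2)]) (simp add: expand[of _ "W _"])
  moreover have "g x (W' u) = (\<Sum>b\<in>Basis. (W' u \<bullet> b) *\<^sub>R g x b)" for u
    using expand[OF assms(2)] .
  ultimately show ?thesis
    unfolding g'_def[symmetric] W'_def[symmetric] by (simp add: sum.distrib)
qed

lemma has_real_derivative_line:
  fixes g :: "'a::real_normed_vector \<Rightarrow> real"
  assumes "g differentiable (at (a + \<tau> *\<^sub>R u))"
  shows "((\<lambda>\<tau>. g (a + \<tau> *\<^sub>R u)) has_real_derivative frechet_derivative g (at (a + \<tau> *\<^sub>R u)) u) (at \<tau>)"
proof -
  have "(g has_derivative frechet_derivative g (at (a + \<tau> *\<^sub>R u))) (at (a + \<tau> *\<^sub>R u))"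
    using assms by (simp add: frechet_derivative_works)
  moreover have "((\<lambda>\<tau>. a + \<tau> *\<^sub>R u) has_derivative (\<lambda>r. r *\<^sub>R u)) (at \<tau>)"
    by (auto intro!: derivative_eq_intros)
  ultimately have "((\<lambda>\<tau>. g (a + \<tau> *\<^sub>R u)) has_derivative
      (\<lambda>r. frechet_derivative g (at (a + \<tau> *\<^sub>R u)) (r *\<^sub>R u))) (at \<tau>)"
    by (rule has_derivative_compose[rotated])
  then show ?thesis
    using assms by (simp add: has_field_derivative_def linear_frechet_derivative linear_scale mult_commute_abs)
qed

text \<open>The mean value theorem is used twice: along \<open>u\<close> for the difference of
  \<open>g\<close> between two parallel edges, then along \<open>v\<close> for the resulting
  difference of first derivatives.\<close>

lemma second_difference_mean_value:
  fixes g :: "'a::real_normed_vector \<Rightarrow> real"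
  assumes in_U: "\<And>\<sigma> \<tau>. 0 \<le> \<sigma> \<Longrightarrow> \<sigma> \<le> s \<Longrightarrow> 0 \<le> \<tau> \<Longrightarrow> \<tau> \<le> s \<Longrightarrow> x + \<sigma> *\<^sub>R u + \<tau> *\<^sub>R v \<in> U"
    and "0 < s" and g: "Ck_on 2 U g"
  obtains \<sigma> \<tau> where "0 < \<sigma>" "\<sigma> < s" "0 < \<tau>" "\<tau> < s"
    "g (x + s *\<^sub>R u + s *\<^sub>R v) - g (x + s *\<^sub>R u) - g (x + s *\<^sub>R v) + g x =
     s * (s * frechet_derivative (\<lambda>y. frechet_derivative g (at y) u) (at (x + \<sigma> *\<^sub>R u + \<tau> *\<^sub>R v)) v)"
proof -
  define g' where "g' y = frechet_derivative g (at y) u" for y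
  have g: "g differentiable (at y)" "g' differentiable (at y)" if "y \<in> U" for y
    using g that unfolding g'_def by (auto simp: numeral_2_eq_2)
  have *: "((\<lambda>\<tau>. g (x + s *\<^sub>R v + \<tau> *\<^sub>R u) - g (x + \<tau> *\<^sub>R u)) has_real_derivative
        g' (x + s *\<^sub>R v + \<tau> *\<^sub>R u) - g' (x + \<tau> *\<^sub>R u)) (at \<tau>)" if "0 \<le> \<tau>" "\<tau> \<le> s" for \<tau>
    using in_U[of \<tau> s] in_U[of \<tau> 0] that \<open>0 < s\<close> unfolding g'_def
    by (intro DERIV_diff has_real_derivative_line g) (simp_all add: ac_simps)
  obtain \<sigma> where \<sigma>: "0 < \<sigma>" "\<sigma> < s"
    "(g (x + s *\<^sub>R v + s *\<^sub>R u) - g (x + s *\<^sub>R u)) - (g (x + s *\<^sub>R v + 0 *\<^sub>R u) - g (x + 0 *\<^sub>R u))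
       = (s - 0) * (g' (x + s *\<^sub>R v + \<sigma> *\<^sub>R u) - g' (x + \<sigma> *\<^sub>R u))"
    using MVT2[OF \<open>0 < s\<close> *] by blast
  have **: "((\<lambda>\<tau>. g' (x + \<sigma> *\<^sub>R u + \<tau> *\<^sub>R v)) has_real_derivative
        frechet_derivative g' (at (x + \<sigma> *\<^sub>R u + \<tau> *\<^sub>R v)) v) (at \<tau>)" if "0 \<le> \<tau>" "\<tau> \<le> s" for \<tau>
    using in_U[of \<sigma> \<tau>] that \<sigma> by (intro has_real_derivative_line g) simp_all
  obtain \<tau> where \<tau>: "0 < \<tau>" "\<tau> < s"
    "g' (x + \<sigma> *\<^sub>R u + s *\<^sub>R v) - g' (x + \<sigma> *\<^sub>R u + 0 *\<^sub>R v)
       = (s - 0) * frechet_derivative g' (at (x + \<sigma> *\<^sub>R u + \<tau> *\<^sub>R v)) v"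
    using MVT2[OF \<open>0 < s\<close> **] by blast
  show thesis
    using that[OF \<sigma>(1,2) \<tau>(1,2)] \<sigma>(3) \<tau>(3) unfolding g'_def[symmetric]
    by (simp add: ac_simps)
qed

text \<open>The second difference over a small parallelogram is symmetric in \<open>u\<close> and
  \<open>v\<close>, so the two mixed derivatives agree at two nearby points; continuity moves both
  points to \<open>x\<close>.\<close>

lemma symmetric_second_derivative_real:
  fixes g :: "'a::real_normed_vector \<Rightarrow> real"
  assumes "open U" "x \<in> U" and g: "Ck_on 2 U g"
  shows "frechet_derivative (\<lambda>y. frechet_derivative g (at y) u) (at x) v =
         frechet_derivative (\<lambda>y. frechet_derivative g (at y) v) (at x) u" (is "?A x = ?B x")
proof -
  define d where "d = (\<lambda>y. ?A y - ?B y)"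
  have "continuous_on U ?A" "continuous_on U ?B"
    using g by (auto simp: numeral_2_eq_2)
  then have A: "isCont ?A x" and B: "isCont ?B x"
    using assms by (simp_all add: continuous_on_eq_continuous_at)
  have "\<bar>?A x - ?B x\<bar> \<le> e" if "0 < e" for e
  proof -
    obtain r1 where r1: "0 < r1" "ball x r1 \<subseteq> U"
      using openE[OF assms(1,2)] .
    obtain r2 where r2: "0 < r2" "\<And>y. dist y x < r2 \<Longrightarrow> dist (?A y) (?A x) < e / 2"
      using continuous_at_eps_delta[THEN iffD1, OF A, rule_format, of "e / 2"] \<open>0 < e\<close> by auto
    obtain r3 where r3: "0 < r3" "\<And>y. dist y x < r3 \<Longrightarrow> dist (?B y) (?B x) < e / 2"
      using continuous_at_eps_delta[THEN iffD1, OF B, rule_format, of "e / 2"] \<open>0 < e\<close> by auto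
    define r where "r = min r1 (min r2 r3)"
    have "0 < r" using r1 r2 r3 by (simp add: r_def)
    \<comment> \<open>This size keeps the whole parallelogram within distance \<open>r\<close> of
      \<open>x\<close>; the summand 1 makes the bound strict and covers
      \<open>u = v = 0\<close>.\<close>
    define s where "s = r / (norm u + norm v + 1)"
    have pos: "0 < norm u + norm v + 1"
      by (simp add: add_nonneg_pos)
    have "0 < s" using \<open>0 < r\<close> pos by (simp add: s_def)
    have near: "dist (x + \<sigma> *\<^sub>R u + \<tau> *\<^sub>R v) x < r" if "0 \<le> \<sigma>" "\<sigma> \<le> s" "0 \<le> \<tau>" "\<tau> \<le> s" for \<sigma> \<tau>
    proof -
      have "norm (\<sigma> *\<^sub>R u + \<tau> *\<^sub>R v) \<le> \<sigma> * norm u + \<tau> * norm v"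
        using that norm_triangle_ineq[of "\<sigma> *\<^sub>R u" "\<tau> *\<^sub>R v"] by simp
      also have "\<dots> \<le> s * norm u + s * norm v"
        using that by (intro add_mono mult_right_mono) auto
      also have "\<dots> < s * (norm u + norm v + 1)"
        using \<open>0 < s\<close> by (simp add: algebra_simps)
      also have "\<dots> = r"
        using pos by (simp add: s_def)
      finally show ?thesis
        by (simp add: dist_norm add.assoc)
    qed
    have in_U: "x + \<sigma> *\<^sub>R u + \<tau> *\<^sub>R v \<in> U" if "0 \<le> \<sigma>" "\<sigma> \<le> s" "0 \<le> \<tau>" "\<tau> \<le> s" for \<sigma> \<tau>
      using near[OF that] r1 by (auto simp: r_def dist_commute)
    have in_U': "x + \<sigma> *\<^sub>R v + \<tau> *\<^sub>R u \<in> U" if "0 \<le> \<sigma>" "\<sigma> \<le> s" "0 \<le> \<tau>" "\<tau> \<le> s" for \<sigma> \<tau>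
      using in_U[OF that(3,4,1,2)] by (simp add: ac_simps)
    obtain \<sigma> \<tau> where 1: "0 < \<sigma>" "\<sigma> < s" "0 < \<tau>" "\<tau> < s"
      "g (x + s *\<^sub>R u + s *\<^sub>R v) - g (x + s *\<^sub>R u) - g (x + s *\<^sub>R v) + g x =
       s * (s * ?A (x + \<sigma> *\<^sub>R u + \<tau> *\<^sub>R v))"
      by (rule second_difference_mean_value[OF in_U \<open>0 < s\<close> g])
    obtain \<sigma>' \<tau>' where 2: "0 < \<sigma>'" "\<sigma>' < s" "0 < \<tau>'" "\<tau>' < s"
      "g (x + s *\<^sub>R v + s *\<^sub>R u) - g (x + s *\<^sub>R v) - g (x + s *\<^sub>R u) + g x =
       s * (s * ?B (x + \<sigma>' *\<^sub>R v + \<tau>' *\<^sub>R u))"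
      by (rule second_difference_mean_value[OF in_U' \<open>0 < s\<close> g])
    have "s * (s * ?A (x + \<sigma> *\<^sub>R u + \<tau> *\<^sub>R v)) = s * (s * ?B (x + \<sigma>' *\<^sub>R v + \<tau>' *\<^sub>R u))"
    proof -
      have "x + s *\<^sub>R v + s *\<^sub>R u = x + s *\<^sub>R u + s *\<^sub>R v"
        by simp
      from 2(5)[unfolded this] 1(5) show ?thesis
        by linarith
    qed
    then have "?A (x + \<sigma> *\<^sub>R u + \<tau> *\<^sub>R v) = ?B (x + \<sigma>' *\<^sub>R v + \<tau>' *\<^sub>R u)"
      using \<open>0 < s\<close> by simp
    moreover have "dist (?A (x + \<sigma> *\<^sub>R u + \<tau> *\<^sub>R v)) (?A x) < e / 2"
      using near[of \<sigma> \<tau>] 1 by (intro r2(2)) (simp add: r_def)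
    moreover have "dist (?B (x + \<sigma>' *\<^sub>R v + \<tau>' *\<^sub>R u)) (?B x) < e / 2"
      using near[of \<tau>' \<sigma>'] 2 by (intro r3(2)) (simp add: r_def ac_simps)
    ultimately show ?thesis
      unfolding dist_real_def by linarith
  qed
  then have "\<bar>?A x - ?B x\<bar> \<le> 0"
    by (rule field_le_epsilon[where y = 0, simplified]) 
  then show ?thesis by simp
qed

lemma frechet_derivative_inner_left:
  assumes "f differentiable (at x)"
  shows "frechet_derivative (\<lambda>x. f x \<bullet> b) (at x) v = frechet_derivative f (at x) v \<bullet> b"
proof -
  have "((\<lambda>x. f x \<bullet> b) has_derivative (\<lambda>v. frechet_derivative f (at x) v \<bullet> b)) (at x)"
    using assms by (auto intro!: derivative_eq_intros simp: frechet_derivative_works[symmetric])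
  then show ?thesis by (rule frechet_derivative_eq)
qed

lemma Ck_on_inner_left:
  assumes "open U" "Ck_on k U f"
  shows "Ck_on k U (\<lambda>x. f x \<bullet> b)"
  using assms(2)
proof (induction k arbitrary: f)
  case 0
  then show ?case by (simp add: continuous_on_inner)
next
  case (Suc k)
  have "Ck_on k U (\<lambda>x. frechet_derivative (\<lambda>x. f x \<bullet> b) (at x) v)" for v
  proof (rule Ck_on_cong[OF \<open>open U\<close>])
    show "Ck_on k U (\<lambda>x. frechet_derivative f (at x) v \<bullet> b)"
      using Suc.prems by (intro Suc.IH) simp
  qed (use Suc.prems in \<open>simp add: frechet_derivative_inner_left\<close>)
  moreover have "(\<lambda>x. f x \<bullet> b) differentiable (at x)" if "x \<in> U" for x
    using Suc.prems that by simp
  ultimately show ?case by simp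
qed

text \<open>Componentwise from the real case. The vector-valued version is what the second
  derivatives of \<open>S\<close> require.\<close>

lemma symmetric_second_derivative:
  fixes g :: "'a::real_normed_vector \<Rightarrow> 'b::euclidean_space"
  assumes "open U" "x \<in> U" and g: "Ck_on 2 U g"
  shows "frechet_derivative (\<lambda>y. frechet_derivative g (at y) u) (at x) v =
         frechet_derivative (\<lambda>y. frechet_derivative g (at y) v) (at x) u"
proof (rule euclidean_eqI)
  fix b :: 'b
  have *: "frechet_derivative (\<lambda>y. frechet_derivative (\<lambda>y. g y \<bullet> b) (at y) u) (at x) v
      = frechet_derivative (\<lambda>y. frechet_derivative g (at y) u) (at x) v \<bullet> b" for u v
  proof -
    have "(\<lambda>y. frechet_derivative g (at y) u) differentiable (at x)"
      using g assms(2) by (simp add: numeral_2_eq_2)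
    then have "((\<lambda>y. frechet_derivative g (at y) u \<bullet> b) has_derivative
        (\<lambda>v. frechet_derivative (\<lambda>y. frechet_derivative g (at y) u) (at x) v \<bullet> b)) (at x)"
      by (auto intro!: derivative_eq_intros simp: frechet_derivative_works[symmetric])
    then have "((\<lambda>y. frechet_derivative (\<lambda>y. g y \<bullet> b) (at y) u) has_derivative
        (\<lambda>v. frechet_derivative (\<lambda>y. frechet_derivative g (at y) u) (at x) v \<bullet> b)) (at x)"
      by (rule has_derivative_transform_within_open[OF _ assms(1,2)])
         (use g in \<open>simp add: frechet_derivative_inner_left numeral_2_eq_2\<close>)
    then show ?thesis by (rule frechet_derivative_eq)
  qed
  show "frechet_derivative (\<lambda>y. frechet_derivative g (at y) u) (at x) v \<bullet> b =
         frechet_derivative (\<lambda>y. frechet_derivative g (at y) v) (at x) u \<bullet> b"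
    by (subst (1 2) *[symmetric])
       (rule symmetric_second_derivative_real[OF assms(1,2) Ck_on_inner_left[OF assms(1) g]])
qed


section \<open>Induced charts of the jet bundle\<close>

lemma coordinate_chart_inj_on:
  assumes "coordinate_chart T c"
  shows "inj_on (snd c) (fst c)"
proof -
  have "inj_on (snd c) (topspace (subtopology T (fst c)))"
    using assms unfolding coordinate_chart_def by (blast intro: homeomorphic_imp_injective_map)
  moreover have "topspace (subtopology T (fst c)) = fst c"
    using assms openin_subset unfolding coordinate_chart_def by fastforce
  ultimately show ?thesis by simp
qed

lemma coordinate_chart_open_image:
  assumes "coordinate_chart T c" "openin T V" "V \<subseteq> fst c"
  shows "open (snd c ` V)"
proof -
  have "open_map (subtopology T (fst c)) (top_of_set (chart_image c)) (snd c)"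
    using assms(1) homeomorphic_imp_open_map unfolding coordinate_chart_def by blast
  moreover have "openin (subtopology T (fst c)) V"
    using assms(1-3) by (simp add: coordinate_chart_def openin_open_subtopology)
  ultimately have "openin (top_of_set (chart_image c)) (snd c ` V)"
    by (simp add: open_map_def)
  then show ?thesis
    using assms(1) openin_open_trans unfolding coordinate_chart_def by blast
qed

lemma chart_inv_in_domain: "x \<in> chart_image c \<Longrightarrow> chart_inv c x \<in> fst c"
  by (rule inv_into_into)

lemma chart_chart_inv: "x \<in> chart_image c \<Longrightarrow> snd c (chart_inv c x) = x"
  by (rule f_inv_into_f)

lemma smooth_manifold_coordinate_chart: "smooth_manifold T A \<Longrightarrow> c \<in> A \<Longrightarrow> coordinate_chart T c"
  by (auto simp: smooth_manifold_def)

lemma smooth_manifold_transition: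
  "smooth_manifold T A \<Longrightarrow> c \<in> A \<Longrightarrow> d \<in> A \<Longrightarrow> smooth_on (snd c ` (fst c \<inter> fst d)) (transition c d)"
  unfolding smooth_manifold_def smoothly_compatible_def by blast

lemma open_overlap_image:
  assumes "smooth_manifold T A" "c \<in> A" "d \<in> A"
  shows "open (snd c ` (fst c \<inter> fst d))"
proof (rule coordinate_chart_open_image)
  show "coordinate_chart T c"
    by (rule smooth_manifold_coordinate_chart[OF assms(1,2)])
  show "openin T (fst c \<inter> fst d)"
    using smooth_manifold_coordinate_chart[OF assms(1,2)] smooth_manifold_coordinate_chart[OF assms(1,3)]
    by (auto simp: coordinate_chart_def)
qed simp

section \<open>Representatives of jets and sections with prescribed velocity\<close>

lemma local_section_jet_representative:
  assumes "j \<in> jet_space A \<pi>"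
  shows "local_section_at A \<pi> (fst j) (jet_representative j)"
proof -
  obtain \<gamma> t where j: "j = jet1 A \<pi> \<gamma> t" and "local_section_at A \<pi> t \<gamma>"
    using assms by (auto simp: jet_space_def)
  then have "\<gamma> \<in> snd j"
    by (simp add: jet1_def)
  then have "jet_representative j \<in> snd j"
    by (rule someI[of "\<lambda>\<gamma>. \<gamma> \<in> snd j"])
  then show ?thesis
    by (simp add: j jet1_def)
qed

lemma proj_jet_proj:
  assumes "j \<in> jet_space A \<pi>"
  shows "\<pi> (jet_proj j) = fst j"
  using local_section_jet_representative[OF assms]
  by (auto simp: local_section_at_def jet_proj_def)

lemma fibred_chart_jet_proj:
  assumes "c \<in> fibred_charts A \<pi>" "j \<in> jet_space A \<pi>" "jet_proj j \<in> fst c"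
  shows "snd c (jet_proj j) = (fst j, snd (snd c (jet_proj j)))"
proof -
  have "fst (snd c (jet_proj j)) = fst j"
    using assms proj_jet_proj[OF assms(2)] by (simp add: fibred_charts_def)
  then show ?thesis
    by (metis prod.collapse)
qed

text \<open>In any other chart \<open>d\<close> the curve is the transition map restricted to a
  straight line, hence smooth. Such curves serve as sections realising a prescribed 1-jet.\<close>

lemma smooth_curve_on_chart_line:
  fixes A :: "('p, 'e::euclidean_space) chart set" and a v :: 'e
  assumes M: "smooth_manifold T A" and c: "c \<in> A"
  defines "I \<equiv> {s. a + s *\<^sub>R v \<in> chart_image c}"
  shows "open I" "smooth_curve_on A I (\<lambda>s. chart_inv c (a + s *\<^sub>R v))"
proof -
  have cont: "continuous_on UNIV (\<lambda>s::real. a + s *\<^sub>R v)"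
    by (intro continuous_intros)
  have op: "open {s. a + s *\<^sub>R v \<in> W}" if "open W" for W
    using open_vimage[OF that cont] by (simp add: vimage_def)
  have "open (chart_image c)"
    using smooth_manifold_coordinate_chart[OF M c] by (simp add: coordinate_chart_def)
  then show "open I"
    unfolding I_def by (rule op)
  have "open {s \<in> I. chart_inv c (a + s *\<^sub>R v) \<in> fst d} \<and>
      smooth_on {s \<in> I. chart_inv c (a + s *\<^sub>R v) \<in> fst d} (snd d \<circ> (\<lambda>s. chart_inv c (a + s *\<^sub>R v)))"
    if d: "d \<in> A" for d
  proof -
    let ?W = "snd c ` (fst c \<inter> fst d)"
    have inj: "inj_on (snd c) (fst c)"
      using coordinate_chart_inj_on smooth_manifold_coordinate_chart[OF M c] by blast
    have eq: "{s \<in> I. chart_inv c (a + s *\<^sub>R v) \<in> fst d} = {s. a + s *\<^sub>R v \<in> ?W}" (is "?L = ?R")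
    proof (intro equalityI subsetI)
      fix s assume "s \<in> ?L"
      then have "a + s *\<^sub>R v \<in> chart_image c" "chart_inv c (a + s *\<^sub>R v) \<in> fst d"
        by (simp_all add: I_def)
      then show "s \<in> ?R"
        using chart_inv_in_domain[of "a + s *\<^sub>R v" c] chart_chart_inv[of "a + s *\<^sub>R v" c]
        by (intro CollectI rev_image_eqI[of "chart_inv c (a + s *\<^sub>R v)"]) simp_all
    next
      fix s assume "s \<in> ?R"
      then obtain p where "p \<in> fst c" "p \<in> fst d" "a + s *\<^sub>R v = snd c p"
        by blast
      then show "s \<in> ?L"
        using inj by (simp add: I_def)
    qed
    have "open ?R"
      by (rule op[OF open_overlap_image[OF M c d]])
    moreover have "smooth_on ?R (\<lambda>s. transition c d (a + s *\<^sub>R v))"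
      using smooth_manifold_transition[OF M c d] \<open>open ?R\<close> unfolding smooth_on_def
      by (blast intro: Ck_on_compose_line)
    ultimately show ?thesis
      unfolding eq by (simp add: o_def)
  qed
  moreover have "(\<lambda>s. chart_inv c (a + s *\<^sub>R v)) ` I \<subseteq> (\<Union>c\<in>A. fst c)"
    using c chart_inv_in_domain[of _ c] by (fastforce simp: I_def)
  ultimately show "smooth_curve_on A I (\<lambda>s. chart_inv c (a + s *\<^sub>R v))"
    by (simp add: smooth_curve_on_def)
qed

text \<open>Velocities are unrestricted: every \<open>y\<close> over a point of the chart of the
  total space is the velocity of a section that is straight in these coordinates.\<close>

lemma jet_chart_image:
  fixes A :: "('p, real \<times> (real^'n)) chart set"
  assumes M: "smooth_manifold T A" and c: "c \<in> fibred_charts A \<pi>"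
  shows "chart_image (jet_chart A \<pi> c) = {(t, x, y). (t, x) \<in> chart_image c}"
proof (intro equalityI subsetI)
  fix z :: "'n jet_model"
  assume "z \<in> chart_image (jet_chart A \<pi> c)"
  then obtain j where j: "j \<in> jet_space A \<pi>" "jet_proj j \<in> fst c"
    and z: "fst z = fst j" "fst (snd z) = snd (snd c (jet_proj j))"
    by (auto simp: jet_chart_def)
  have "(fst z, fst (snd z)) \<in> chart_image c"
    unfolding z fibred_chart_jet_proj[OF c j, symmetric] using j by blast
  then show "z \<in> {(t, x, y). (t, x) \<in> chart_image c}"
    by (auto simp: case_prod_unfold)
next
  fix z :: "'n jet_model"
  assume "z \<in> {(t, x, y). (t, x) \<in> chart_image c}"
  then obtain t x y where z: "z = (t, x, y)" and tx: "(t, x) \<in> chart_image c"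
    by blast
  have cA: "c \<in> A" and fib: "\<And>p. p \<in> fst c \<Longrightarrow> \<pi> p = fst (snd c p)"
    using c by (auto simp: fibred_charts_def)
  \<comment> \<open>In coordinates this is \<open>(s, x + (s - t) *\<^sub>R y)\<close>: the first
    entry makes it a section, and at \<open>s = t\<close> it passes through \<open>(t, x)\<close>
    with velocity \<open>y\<close>.\<close>
  define \<gamma> where "\<gamma> s = chart_inv c ((0, x - t *\<^sub>R y) + s *\<^sub>R (1, y))" for s
  define I where "I = {s. (0, x - t *\<^sub>R y) + s *\<^sub>R (1, y) \<in> chart_image c}"
  have I: "open I" "smooth_curve_on A I \<gamma>"
    using smooth_curve_on_chart_line[OF M cA, of "(0, x - t *\<^sub>R y)" "(1, y)"]
    by (auto simp: I_def \<gamma>_def[abs_def])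
  have \<gamma>: "snd c (\<gamma> s) = (s, x + (s - t) *\<^sub>R y)" "\<gamma> s \<in> fst c" if "s \<in> I" for s
    using that chart_chart_inv[of _ c] chart_inv_in_domain[of _ c]
    by (auto simp: I_def \<gamma>_def algebra_simps)
  have "t \<in> I"
    using tx by (simp add: I_def)
  have sec: "local_section_at A \<pi> t \<gamma>"
    unfolding local_section_at_def using I \<open>t \<in> I\<close> \<gamma> fib by auto
  define j where "j = jet1 A \<pi> \<gamma> t"
  have j: "j \<in> jet_space A \<pi>" "fst j = t"
    using sec by (auto simp: j_def jet_space_def jet1_def)
  have "\<gamma> \<in> snd j"
    using sec by (simp add: j_def jet1_def)
  then have "jet_representative j \<in> snd j"
    by (rule someI[of "\<lambda>\<gamma>. \<gamma> \<in> snd j"])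
  \<comment> \<open>The representative picked by \<open>SOME\<close> may differ from
    \<open>\<gamma>\<close>, but first-order contact gives it the same value and velocity at
    \<open>t\<close>, which is all that the jet chart reads.\<close>
  then have rep: "jet_representative j t = \<gamma> t"
      "vector_derivative (snd c \<circ> jet_representative j) (at t) = vector_derivative (snd c \<circ> \<gamma>) (at t)"
    using cA \<gamma>(2)[OF \<open>t \<in> I\<close>] by (simp_all add: j_def jet1_def)
  have "((\<lambda>s. (s, x + (s - t) *\<^sub>R y)) has_vector_derivative (1, y)) (at t)"
    by (auto intro!: derivative_eq_intros simp: has_vector_derivative_def)
  then have "((snd c \<circ> \<gamma>) has_vector_derivative (1, y)) (at t)"
    by (rule has_vector_derivative_transform_within_open[OF _ I(1) \<open>t \<in> I\<close>]) (simp add: \<gamma>)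
  then have "snd (jet_chart A \<pi> c) j = z"
    using \<gamma>(1)[OF \<open>t \<in> I\<close>] j rep
    by (simp add: jet_chart_def jet_proj_def z vector_derivative_at)
  moreover have "j \<in> fst (jet_chart A \<pi> c)"
    using j rep \<gamma>(2)[OF \<open>t \<in> I\<close>] by (simp add: jet_chart_def jet_proj_def)
  ultimately show "z \<in> chart_image (jet_chart A \<pi> c)"
    by blast
qed

lemma open_jet_chart_image:
  fixes A :: "('p, real \<times> (real^'n)) chart set"
  assumes M: "smooth_manifold T A" and "d \<in> jet_atlas A \<pi>"
  shows "open (chart_image d)"
proof -
  obtain c where c: "c \<in> fibred_charts A \<pi>" "d = jet_chart A \<pi> c"
    using assms by (auto simp: jet_atlas_def)
  have "open (chart_image c)"
    using c smooth_manifold_coordinate_chart[OF M, of c]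
    by (simp add: fibred_charts_def coordinate_chart_def)
  moreover have "continuous_on UNIV (\<lambda>z :: 'n jet_model. (fst z, fst (snd z)))"
    by (intro continuous_intros)
  ultimately have "open ((\<lambda>z :: 'n jet_model. (fst z, fst (snd z))) -` chart_image c)"
    by (rule open_vimage)
  then show ?thesis
    unfolding c(2) jet_chart_image[OF M c(1)] by (simp add: vimage_def case_prod_unfold)
qed

text \<open>In a jet chart the projection to the total space forgets \<open>y\<close>, so its
  derivative kills the last component. This turns the invariant notion of a semi-basic form into a
  coordinate condition.\<close>

lemma vertical_fibre_direction:
  assumes M: "smooth_manifold T A" and d: "d \<in> jet_atlas A \<pi>" and z: "z \<in> chart_image d"
  shows "vertical A d z (0, 0, w)"
  unfolding vertical_def
proof (intro ballI impI)
  fix c' assume c': "c' \<in> A" and dom: "jet_proj (chart_inv d z) \<in> fst c'"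
  obtain c where c: "c \<in> fibred_charts A \<pi>" and dc: "d = jet_chart A \<pi> c"
    using d by (auto simp: jet_atlas_def)
  then have cA: "c \<in> A"
    by (simp add: fibred_charts_def)
  have inv: "jet_proj (chart_inv d y) \<in> fst c"
      "snd c (jet_proj (chart_inv d y)) = (fst y, fst (snd y))" if y: "y \<in> chart_image d" for y
  proof -
    have j: "chart_inv d y \<in> jet_space A \<pi>" "jet_proj (chart_inv d y) \<in> fst c"
      using chart_inv_in_domain[OF y] by (auto simp: dc jet_chart_def)
    then show "jet_proj (chart_inv d y) \<in> fst c" by simp
    have "fst (snd d j) = fst j" "fst (snd (snd d j)) = snd (snd c (jet_proj j))" for j
      by (simp_all add: dc jet_chart_def)
    from this[of "chart_inv d y"] show "snd c (jet_proj (chart_inv d y)) = (fst y, fst (snd y))"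
      using fibred_chart_jet_proj[OF c j] chart_chart_inv[OF y] by simp
  qed
  have inj: "inj_on (snd c) (fst c)"
    using coordinate_chart_inj_on smooth_manifold_coordinate_chart[OF M cA] by blast
  have "(fst z, fst (snd z)) \<in> snd c ` (fst c \<inter> fst c')"
    using inv[OF z] dom by (metis IntI image_eqI)
  then have "transition c c' differentiable (at (fst z, fst (snd z)))"
    using smooth_on_differentiable smooth_manifold_transition[OF M cA c'] by blast
  then obtain D where D: "(transition c c' has_derivative D) (at (fst z, fst (snd z)))"
    by (auto simp: differentiable_def)
  have "((\<lambda>y. (fst y, fst (snd y))) has_derivative (\<lambda>v. (fst v, fst (snd v)))) (at z)"
    by (auto intro!: derivative_eq_intros)
  \<comment> \<open>Read in \<open>c'\<close>, the projection is the transition map from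
    \<open>c\<close> to \<open>c'\<close> after dropping \<open>y\<close>.\<close>
  from has_derivative_compose[OF this D]
  have "((\<lambda>y. transition c c' (fst y, fst (snd y))) has_derivative (\<lambda>v. D (fst v, fst (snd v)))) (at z)" .
  then have "((snd c' \<circ> jet_proj \<circ> chart_inv d) has_derivative (\<lambda>v. D (fst v, fst (snd v)))) (at z)"
  proof (rule has_derivative_transform_within_open[OF _ open_jet_chart_image[OF M d] z])
    fix y assume "y \<in> chart_image d"
    from inv[OF this]
    show "transition c c' (fst y, fst (snd y)) = (snd c' \<circ> jet_proj \<circ> chart_inv d) y"
      using inv_into_f_f[OF inj] by (metis comp_apply)
  qed
  then have "frechet_derivative (snd c' \<circ> jet_proj \<circ> chart_inv d) (at z) (0, 0, w) = D (0, 0)"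
    by (simp add: frechet_derivative_eq)
  also have "\<dots> = 0"
    using linear_0[OF has_derivative_linear[OF D]] by (simp add: zero_prod_def)
  finally show "frechet_derivative (snd c' \<circ> jet_proj \<circ> chart_inv d) (at z) (0, 0, w) = 0" .
qed


section \<open>Skew forms and wedge products with dt\<close>

lemma bilinearI:
  assumes "\<And>u u' v. f (u + u') v = f u v + f u' v" "\<And>r u v. f (r *\<^sub>R u) v = r *\<^sub>R f u v"
    and "\<And>u v v'. f u (v + v') = f u v + f u v'" "\<And>r u v. f u (r *\<^sub>R v) = r *\<^sub>R f u v"
  shows "bilinear f"
  using assms by (simp add: bilinear_def linear_iff)

text \<open>Models the value of a 2-form at one point as a binary function instead of a function of
  lists, so that bilinear algebra applies directly.\<close>

definition skew_form :: "('e::real_vector \<Rightarrow> 'e \<Rightarrow> real) \<Rightarrow> bool" where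
  "skew_form \<beta> \<longleftrightarrow> bilinear \<beta> \<and> (\<forall>u v. \<beta> u v = - \<beta> v u)"

text \<open>The operator \<open>i_endo\<close> on 2-forms at one point, in the same binary
  notation.\<close>

definition insert_endo :: "('e \<Rightarrow> 'e) \<Rightarrow> ('e \<Rightarrow> 'e \<Rightarrow> real) \<Rightarrow> 'e \<Rightarrow> 'e \<Rightarrow> real" where
  "insert_endo B \<beta> u v = \<beta> (B u) v + \<beta> u (B v)"

lemma skew_form_swap: "skew_form \<beta> \<Longrightarrow> \<beta> u v = - \<beta> v u"
  unfolding skew_form_def by blast

lemma skew_form_linear:
  assumes "skew_form \<beta>"
  shows "\<beta> (u + u') v = \<beta> u v + \<beta> u' v" "\<beta> (r *\<^sub>R u) v = r * \<beta> u v" "\<beta> (- u) v = - \<beta> u v"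
    "\<beta> (u - u') v = \<beta> u v - \<beta> u' v" "\<beta> 0 v = 0"
    "\<beta> u (v + v') = \<beta> u v + \<beta> u v'" "\<beta> u (r *\<^sub>R v) = r * \<beta> u v" "\<beta> u (- v) = - \<beta> u v"
    "\<beta> u (v - v') = \<beta> u v - \<beta> u v'" "\<beta> u 0 = 0"
proof -
  have "bilinear \<beta>"
    using assms unfolding skew_form_def by blast
  then show "\<beta> (u + u') v = \<beta> u v + \<beta> u' v" "\<beta> (r *\<^sub>R u) v = r * \<beta> u v" "\<beta> (- u) v = - \<beta> u v"
    "\<beta> (u - u') v = \<beta> u v - \<beta> u' v" "\<beta> 0 v = 0"
    "\<beta> u (v + v') = \<beta> u v + \<beta> u v'" "\<beta> u (r *\<^sub>R v) = r * \<beta> u v" "\<beta> u (- v) = - \<beta> u v"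
    "\<beta> u (v - v') = \<beta> u v - \<beta> u v'" "\<beta> u 0 = 0"
    by (simp_all add: bilinear_ladd bilinear_lmul bilinear_lneg bilinear_lsub bilinear_lzero
      bilinear_radd bilinear_rmul bilinear_rneg bilinear_rsub bilinear_rzero)
qed

lemma skew_formI: "bilinear \<beta> \<Longrightarrow> (\<And>u v. \<beta> u v = - \<beta> v u) \<Longrightarrow> skew_form \<beta>"
  unfolding skew_form_def by blast

lemma skew_form_insert_endo:
  assumes "skew_form \<beta>" "linear B"
  shows "skew_form (insert_endo B \<beta>)"
proof (rule skew_formI)
  show "bilinear (insert_endo B \<beta>)"
    using assms(2) by (intro bilinearI)
      (simp_all add: insert_endo_def linear_add linear_scale skew_form_linear[OF assms(1)] algebra_simps)
  show "insert_endo B \<beta> u v = - insert_endo B \<beta> v u" for u v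
    using skew_form_swap[OF assms(1), of "B u" v] skew_form_swap[OF assms(1), of u "B v"]
    by (simp add: insert_endo_def)
qed

lemma skew_form_add:
  assumes "skew_form \<alpha>" "skew_form \<beta>"
  shows "skew_form (\<lambda>u v. \<alpha> u v + \<beta> u v)"
proof (rule skew_formI)
  show "bilinear (\<lambda>u v. \<alpha> u v + \<beta> u v)"
    by (intro bilinearI)
      (simp_all add: skew_form_linear[OF assms(1)] skew_form_linear[OF assms(2)] algebra_simps)
  show "\<alpha> u v + \<beta> u v = - (\<alpha> v u + \<beta> v u)" for u v
    using skew_form_swap[OF assms(1), of u v] skew_form_swap[OF assms(2), of u v] by simp
qed

lemma skew_form_diff:
  assumes "skew_form \<alpha>" "skew_form \<beta>"
  shows "skew_form (\<lambda>u v. \<alpha> u v - \<beta> u v)"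
proof (rule skew_formI)
  show "bilinear (\<lambda>u v. \<alpha> u v - \<beta> u v)"
    by (intro bilinearI)
      (simp_all add: skew_form_linear[OF assms(1)] skew_form_linear[OF assms(2)] algebra_simps)
  show "\<alpha> u v - \<beta> u v = - (\<alpha> v u - \<beta> v u)" for u v
    using skew_form_swap[OF assms(1), of u v] skew_form_swap[OF assms(2), of u v] by simp
qed

section \<open>Restriction of 2-forms to the kernel of \<open>dt\<close>\<close>

definition vanishes_on_ker_dt :: "('n::finite jet_model \<Rightarrow> 'n jet_model \<Rightarrow> real) \<Rightarrow> bool" where
  "vanishes_on_ker_dt \<beta> \<longleftrightarrow> (\<forall>u v. fst u = 0 \<longrightarrow> fst v = 0 \<longrightarrow> \<beta> u v = 0)"

text \<open>A third argument with \<open>dt\<close> equal to 1 recovers the value of the 2-form on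
  two vectors of the kernel. Conversely, a 2-form vanishing on the kernel is \<open>dt\<close>
  wedged with a 1-form, and a second factor \<open>dt\<close> kills it.\<close>

lemma wedge1_dt_eq_0_iff:
  fixes c :: "('p jet, 'n::finite jet_model) chart"
  assumes \<beta>: "skew_form \<beta>" and \<alpha>: "\<And>u v. \<alpha> c x [u, v] = \<beta> u v"
  shows "(\<forall>vs. length vs = 3 \<longrightarrow> wedge1 \<alpha> dt c x vs = 0) \<longleftrightarrow> vanishes_on_ker_dt \<beta>"
proof -
  have wedge: "wedge1 \<alpha> dt c x [u, v, w] = \<beta> v w * fst u - \<beta> u w * fst v + \<beta> u v * fst w" for u v w
    by (simp add: wedge1_def dt_def \<alpha> numeral_3_eq_3 lessThan_Suc)
  show ?thesis
    unfolding vanishes_on_ker_dt_def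
  proof (intro iffI allI impI)
    fix u v :: "'n jet_model"
    assume "\<forall>vs. length vs = 3 \<longrightarrow> wedge1 \<alpha> dt c x vs = 0" and "fst u = 0" "fst v = 0"
    moreover from this have "wedge1 \<alpha> dt c x [u, v, (1, 0, 0)] = 0"
      by simp
    ultimately show "\<beta> u v = 0"
      by (simp add: wedge)
  next
    fix vs :: "'n jet_model list"
    assume 0: "\<forall>u v. fst u = 0 \<longrightarrow> fst v = 0 \<longrightarrow> \<beta> u v = 0" and "length vs = 3"
    then obtain u v w where vs: "vs = [u, v, w]"
      by (auto simp: numeral_3_eq_3 length_Suc_conv)
    define e :: "'n jet_model" where "e = (1, 0, 0)"
    \<comment> \<open>Removing the \<open>e\<close>-components puts both arguments into the kernel
      of \<open>dt\<close>; expanding gives \<open>\<beta>\<close> as \<open>dt\<close> wedged with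
      its contraction by \<open>e\<close>.\<close>
    have split: "\<beta> u v = fst u * \<beta> e v - fst v * \<beta> e u" for u v
    proof -
      have "\<beta> (u - fst u *\<^sub>R e) (v - fst v *\<^sub>R e) = 0"
        by (intro 0[rule_format]) (simp_all add: e_def)
      moreover have "\<beta> e e = 0" "\<beta> u e = - \<beta> e u"
        using skew_form_swap[OF \<beta>, of e e] skew_form_swap[OF \<beta>, of u e] by simp_all
      ultimately show ?thesis
        by (simp add: skew_form_linear[OF \<beta>])
    qed
    show "wedge1 \<alpha> dt c x vs = 0"
      unfolding vs wedge split[of v w] split[of u w] split[of u v] by (simp add: algebra_simps)
  qed
qed

lemma lie_bracket_const_left [simp]: "lie_bracket S (\<lambda>_ _. v) c x = - frechet_derivative (S c) (at x) v"
  by (simp add: lie_bracket_def)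

lemma apply_endo_const: "apply_endo A (\<lambda>_ _. v) c = (\<lambda>x. A c x v)"
  by (simp add: fun_eq_iff apply_endo_def)

lemma vert_endo_eq: "vert_endo c x v = (0, 0, fst (snd v) - fst v *\<^sub>R snd (snd x))"
  by (simp add: vert_endo_def case_prod_unfold)

text \<open>No differentiability is assumed: both derivatives are chosen by the same operator from
  predicates that coincide.\<close>

lemma frechet_derivative_cong_open:
  assumes "open U" "x \<in> U" "\<And>z. z \<in> U \<Longrightarrow> f z = g z"
  shows "frechet_derivative f (at x) = frechet_derivative g (at x)"
proof -
  have "(f has_derivative D) (at x) \<longleftrightarrow> (g has_derivative D) (at x)" for D
    using assms by (metis has_derivative_transform_within_open)
  then show ?thesis
    by (simp add: frechet_derivative_def)
qed

lemma ext_d_pair: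
  "ext_d \<alpha> c x [u, v] =
    frechet_derivative (\<lambda>z. \<alpha> c z [v]) (at x) u - frechet_derivative (\<lambda>z. \<alpha> c z [u]) (at x) v"
  by (simp add: ext_d_def lessThan_Suc)

lemma d_endo_pair:
  "d_endo B \<alpha> c x [u, v] =
    insert_endo (B c x) (\<lambda>u v. ext_d \<alpha> c x [u, v]) u v - ext_d (i_endo B \<alpha>) c x [u, v]"
  by (simp add: d_endo_def i_endo_def insert_endo_def lessThan_Suc)


section \<open>The geometry of a semispray in one chart\<close>

locale jet_patch =
  fixes c :: "('p jet, 'n::finite jet_model) chart"
    and S :: "('p jet, 'n jet_model) vfield"
    and \<theta> :: "('p jet, 'n jet_model) form"
  assumes open_image: "open (chart_image c)"
    and S_smooth: "smooth_on (chart_image c) (S c)"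
    and vert_endo_S: "\<And>x. x \<in> chart_image c \<Longrightarrow> vert_endo c x (S c x) = 0"
    and dt_S: "\<And>x. x \<in> chart_image c \<Longrightarrow> dt c x [S c x] = 1"
    and \<theta>_smooth: "\<And>v. smooth_on (chart_image c) (\<lambda>x. \<theta> c x [v])"
    and \<theta>_linear: "\<And>x. x \<in> chart_image c \<Longrightarrow> linear (\<lambda>v. \<theta> c x [v])"
    and \<theta>_vertical: "\<And>x b. x \<in> chart_image c \<Longrightarrow> \<theta> c x [(0, 0, b)] = 0"
begin

abbreviation U :: "'n jet_model set" where "U \<equiv> chart_image c"

abbreviation DS :: "'n jet_model \<Rightarrow> 'n jet_model \<Rightarrow> 'n jet_model" where
  "DS x \<equiv> frechet_derivative (S c) (at x)"

section \<open>The exterior derivative of the semi-basic form\<close>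

definition \<omega> :: "'n jet_model \<Rightarrow> 'n jet_model \<Rightarrow> 'n jet_model \<Rightarrow> real" where
  "\<omega> x u v = ext_d \<theta> c x [u, v]"

lemma \<omega>_eq:
  "\<omega> x u v = frechet_derivative (\<lambda>z. \<theta> c z [v]) (at x) u - frechet_derivative (\<lambda>z. \<theta> c z [u]) (at x) v"
  by (simp add: \<omega>_def ext_d_pair)

lemma \<theta>_differentiable: "x \<in> U \<Longrightarrow> (\<lambda>z. \<theta> c z [v]) differentiable (at x)"
  using smooth_on_differentiable[OF \<theta>_smooth] .

lemma S_differentiable: "x \<in> U \<Longrightarrow> S c differentiable (at x)"
  using smooth_on_differentiable[OF S_smooth] .

lemma linear_DS: "x \<in> U \<Longrightarrow> linear (DS x)"
  using S_differentiable linear_frechet_derivative by blast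

lemma D\<theta>_add:
  assumes "x \<in> U"
  shows "frechet_derivative (\<lambda>z. \<theta> c z [v + v']) (at x) u =
    frechet_derivative (\<lambda>z. \<theta> c z [v]) (at x) u + frechet_derivative (\<lambda>z. \<theta> c z [v']) (at x) u"
proof -
  have "((\<lambda>z. \<theta> c z [v] + \<theta> c z [v']) has_derivative (\<lambda>u. frechet_derivative (\<lambda>z. \<theta> c z [v]) (at x) u
      + frechet_derivative (\<lambda>z. \<theta> c z [v']) (at x) u)) (at x)"
    using \<theta>_differentiable[OF assms] by (intro has_derivative_add) (simp_all add: frechet_derivative_works[symmetric])
  moreover have "frechet_derivative (\<lambda>z. \<theta> c z [v + v']) (at x) = frechet_derivative (\<lambda>z. \<theta> c z [v] + \<theta> c z [v']) (at x)"
    by (rule frechet_derivative_cong_open[OF open_image assms]) (simp add: linear_add[OF \<theta>_linear])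
  ultimately show ?thesis
    by (simp add: frechet_derivative_eq)
qed

lemma D\<theta>_scale:
  assumes "x \<in> U"
  shows "frechet_derivative (\<lambda>z. \<theta> c z [r *\<^sub>R v]) (at x) u = r * frechet_derivative (\<lambda>z. \<theta> c z [v]) (at x) u"
proof -
  have "((\<lambda>z. r * \<theta> c z [v]) has_derivative (\<lambda>u. r * frechet_derivative (\<lambda>z. \<theta> c z [v]) (at x) u)) (at x)"
    using \<theta>_differentiable[OF assms] by (intro has_derivative_mult_right) (simp add: frechet_derivative_works[symmetric])
  moreover have "frechet_derivative (\<lambda>z. \<theta> c z [r *\<^sub>R v]) (at x) = frechet_derivative (\<lambda>z. r * \<theta> c z [v]) (at x)"
    by (rule frechet_derivative_cong_open[OF open_image assms]) (simp add: linear_scale[OF \<theta>_linear])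
  ultimately show ?thesis
    by (simp add: frechet_derivative_eq)
qed

lemma linear_D\<theta>: "x \<in> U \<Longrightarrow> linear (frechet_derivative (\<lambda>z. \<theta> c z [v]) (at x))"
  using \<theta>_differentiable linear_frechet_derivative by blast

lemma skew_\<omega>: "x \<in> U \<Longrightarrow> skew_form (\<omega> x)"
  by (intro skew_formI bilinearI)
     (simp_all add: \<omega>_eq D\<theta>_add D\<theta>_scale linear_add[OF linear_D\<theta>] linear_scale[OF linear_D\<theta>] algebra_simps)

lemma \<omega>_differentiable: "x \<in> U \<Longrightarrow> (\<lambda>z. \<omega> z u v) differentiable (at x)"
  unfolding \<omega>_eq
  by (intro differentiable_diff smooth_on_differentiable[OF smooth_on_frechet_derivative[OF \<theta>_smooth]])

text \<open>\<open>\<theta>\<close> annihilates constant vertical fields on all of \<open>U\<close>,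
  so both derivative terms of \<open>d\<theta>\<close> vanish on a vertical pair.\<close>

lemma \<omega>_vertical: "x \<in> U \<Longrightarrow> \<omega> x (0, 0, b) (0, 0, b') = 0"
proof -
  assume x: "x \<in> U"
  have "frechet_derivative (\<lambda>z. \<theta> c z [(0, 0, b)]) (at x) = (\<lambda>_. 0)" for b
    using frechet_derivative_cong_open[OF open_image x, of "\<lambda>z. \<theta> c z [(0, 0, b)]" "\<lambda>_. 0"]
    by (simp add: \<theta>_vertical)
  then show ?thesis
    by (simp add: \<omega>_eq)
qed

section \<open>Coordinate form of the semispray and its projectors\<close>

lemma S_components: "x \<in> U \<Longrightarrow> fst (S c x) = 1" "x \<in> U \<Longrightarrow> fst (snd (S c x)) = snd (snd x)"
  using vert_endo_S[of x] dt_S[of x] by (simp_all add: vert_endo_eq dt_def zero_prod_def)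

lemma DS_components:
  assumes "x \<in> U"
  shows "fst (DS x v) = 0" "fst (snd (DS x v)) = snd (snd v)"
proof -
  have D: "(S c has_derivative DS x) (at x)"
    using S_differentiable[OF assms] by (simp add: frechet_derivative_works[symmetric])
  have "((\<lambda>z. fst (S c z)) has_derivative (\<lambda>v. fst (DS x v))) (at x)"
    by (rule has_derivative_fst[OF D])
  moreover have "((\<lambda>z. fst (S c z)) has_derivative (\<lambda>v. 0)) (at x)"
    by (rule has_derivative_transform_within_open[OF has_derivative_const open_image assms])
       (simp add: S_components)
  ultimately show "fst (DS x v) = 0"
    using has_derivative_unique by metis
  have "((\<lambda>z. fst (snd (S c z))) has_derivative (\<lambda>v. fst (snd (DS x v)))) (at x)"
    by (intro has_derivative_fst has_derivative_snd D)
  moreover have "((\<lambda>z. fst (snd (S c z))) has_derivative (\<lambda>v. snd (snd v))) (at x)"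
    by (rule has_derivative_transform_within_open[of "\<lambda>z. snd (snd z)", OF _ open_image assms])
       (auto intro!: derivative_eq_intros simp: S_components)
  ultimately show "fst (snd (DS x v)) = snd (snd v)"
    using has_derivative_unique by metis
qed

text \<open>The connection coefficients of \<open>S\<close> are \<open>- F / 2\<close>.\<close>
definition F :: "'n jet_model \<Rightarrow> (real^'n) \<Rightarrow> (real^'n)" where
  "F x b = snd (snd (DS x (0, 0, b)))"

lemma DS_vertical: "x \<in> U \<Longrightarrow> DS x (0, 0, b) = (0, b, F x b)"
  by (simp add: prod_eq_iff DS_components F_def)

lemma linear_F: "x \<in> U \<Longrightarrow> linear (F x)"
  using linear_add[OF linear_DS, of x "(0, 0, _)" "(0, 0, _)"] linear_scale[OF linear_DS, of x _ "(0, 0, _)"]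
  by (simp add: linear_iff F_def) 

text \<open>The formula encodes that \<open>h\<close> fixes \<open>S\<close>, kills vertical vectors
  and lifts \<open>(0, b, 0)\<close> to \<open>(0, b, F b / 2)\<close>.\<close>

lemma hor_proj_eq:
  assumes "x \<in> U"
  shows "hor_proj S c x v =
    (fst v, fst (snd v), fst v *\<^sub>R snd (snd (S c x)) + (1/2) *\<^sub>R F x (fst (snd v) - fst v *\<^sub>R snd (snd x)))"
proof -
  have "((\<lambda>z. vert_endo c z v) has_derivative (\<lambda>u. (0, 0, - (fst v *\<^sub>R snd (snd u))))) (at x)"
    unfolding vert_endo_eq by (auto intro!: derivative_eq_intros)
  then have "frechet_derivative (\<lambda>z. vert_endo c z v) (at x) (S c x) = (0, 0, - (fst v *\<^sub>R snd (snd (S c x))))"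
    by (rule frechet_derivative_eq)
  then have L: "lie_endo S vert_endo c x v = (0, - (fst (snd v) - fst v *\<^sub>R snd (snd x)),
      snd (snd v) - fst v *\<^sub>R snd (snd (S c x)) - F x (fst (snd v) - fst v *\<^sub>R snd (snd x)))"
    unfolding lie_endo_def lie_bracket_const_left
    by (simp add: lie_bracket_def apply_endo_const vert_endo_eq[of _ _ v] DS_vertical[OF assms])
       (simp add: vert_endo_eq apply_endo_def DS_vertical[OF assms] DS_components[OF assms])
  show ?thesis
    unfolding hor_proj_def L
    by (simp add: dt_def prod_eq_iff S_components[OF assms] vec_eq_iff field_simps)
qed

lemma linear_hor_proj:
  assumes "x \<in> U"
  shows "linear (hor_proj S c x)"
proof -
  note F = linear_add[OF linear_F[OF assms]] linear_scale[OF linear_F[OF assms]]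
  have "F x (b - a *\<^sub>R y) = F x b - a *\<^sub>R F x y" for a b y
    by (simp add: linear_diff[OF linear_F[OF assms]] F)
  then show ?thesis
    unfolding linear_iff hor_proj_eq[OF assms] by (simp only:) (simp add: F algebra_simps)
qed

lemma hor_proj_vertical [simp]: "x \<in> U \<Longrightarrow> hor_proj S c x (0, 0, b) = 0"
  using linear_0[OF linear_F] by (simp add: hor_proj_eq zero_prod_def)

lemma hor_proj_hor_proj [simp]: "x \<in> U \<Longrightarrow> hor_proj S c x (hor_proj S c x v) = hor_proj S c x v"
  by (simp add: hor_proj_eq)

lemma hor_proj_components [simp]:
  "x \<in> U \<Longrightarrow> fst (hor_proj S c x v) = fst v" "x \<in> U \<Longrightarrow> fst (snd (hor_proj S c x v)) = fst (snd v)"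
  by (simp_all add: hor_proj_eq)

text \<open>Only the \<open>y\<close>-component of \<open>h v\<close> varies with the point, so the
  derivative is vertical. The form of \<open>G\<close> is left open on purpose.\<close>

lemma hor_proj_differentiable:
  assumes x: "x \<in> U"
  obtains G where "((\<lambda>z. hor_proj S c z v) has_derivative (\<lambda>u. (0, 0, G u))) (at x)"
proof -
  let ?b = "\<lambda>z. fst (snd v) - fst v *\<^sub>R snd (snd z)"
  have D: "(S c has_derivative DS x) (at x)"
    using S_differentiable[OF x] by (simp add: frechet_derivative_works[symmetric])
  have "(\<lambda>z. F z b) differentiable (at x)" for b
  proof -
    obtain D where "((\<lambda>z. DS z (0, 0, b)) has_derivative D) (at x)"
      using smooth_on_differentiable[OF smooth_on_frechet_derivative[OF S_smooth] x]
      unfolding differentiable_def by blast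
    from differentiableI[OF has_derivative_snd[OF has_derivative_snd[OF this]]] show ?thesis
      unfolding F_def .
  qed
  moreover have "?b differentiable (at x)"
    unfolding differentiable_def by (auto intro!: derivative_eq_intros)
  \<comment> \<open>Both the linear map \<open>F z\<close> and its argument depend on the point,
    hence the product rule for pairings.\<close>
  ultimately obtain G where "((\<lambda>z. F z (?b z)) has_derivative G) (at x)"
    using has_derivative_linear_apply[where g = F and W = ?b, OF open_image x linear_F] by blast
  then have "((\<lambda>z. (fst v, fst (snd v), fst v *\<^sub>R snd (snd (S c z)) + (1/2) *\<^sub>R F z (?b z))) has_derivative
      (\<lambda>u. (0, 0, fst v *\<^sub>R snd (snd (DS x u)) + (1/2) *\<^sub>R G u))) (at x)"
    by (intro has_derivative_Pair has_derivative_const has_derivative_add has_derivative_scaleR_right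
        has_derivative_snd D)
  then have "((\<lambda>z. hor_proj S c z v) has_derivative
      (\<lambda>u. (0, 0, fst v *\<^sub>R snd (snd (DS x u)) + (1/2) *\<^sub>R G u))) (at x)"
    by (rule has_derivative_transform_within_open[OF _ open_image x]) (simp add: hor_proj_eq)
  then show thesis by (rule that)
qed

text \<open>The derivative of the horizontal projector along \<open>S\<close>. It is vertical, so its value, which
  involves second derivatives of \<open>S\<close>, never has to be computed.\<close>
definition K :: "'n jet_model \<Rightarrow> 'n jet_model \<Rightarrow> 'n jet_model" where
  "K x v = frechet_derivative (\<lambda>z. hor_proj S c z v) (at x) (S c x)"

lemma hor_proj_has_derivative:
  "x \<in> U \<Longrightarrow> ((\<lambda>z. hor_proj S c z v) has_derivative frechet_derivative (\<lambda>z. hor_proj S c z v) (at x)) (at x)"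
  by (metis hor_proj_differentiable differentiable_def frechet_derivative_works)

lemma K_components [simp]: "x \<in> U \<Longrightarrow> fst (K x v) = 0" "x \<in> U \<Longrightarrow> fst (snd (K x v)) = 0"
proof -
  assume "x \<in> U"
  then obtain G where "((\<lambda>z. hor_proj S c z v) has_derivative (\<lambda>u. (0, 0, G u))) (at x)"
    by (rule hor_proj_differentiable)
  from frechet_derivative_eq[OF this, of "S c x"]
  show "fst (K x v) = 0" "fst (snd (K x v)) = 0"
    by (simp_all add: K_def)
qed

lemma linear_K:
  assumes x: "x \<in> U"
  shows "linear (K x)"
proof -
  have "K x (u + v) = K x u + K x v" for u v
  proof -
    have "((\<lambda>z. hor_proj S c z (u + v)) has_derivative
       (\<lambda>w. frechet_derivative (\<lambda>z. hor_proj S c z u) (at x) w + frechet_derivative (\<lambda>z. hor_proj S c z v) (at x) w)) (at x)"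
      by (rule has_derivative_transform_within_open[OF has_derivative_add[OF hor_proj_has_derivative hor_proj_has_derivative] open_image x])
         (simp_all add: x linear_add[OF linear_hor_proj])
    then show ?thesis
      unfolding K_def by (rule frechet_derivative_eq)
  qed
  moreover have "K x (r *\<^sub>R v) = r *\<^sub>R K x v" for r v
  proof -
    have "((\<lambda>z. hor_proj S c z (r *\<^sub>R v)) has_derivative
       (\<lambda>w. r *\<^sub>R frechet_derivative (\<lambda>z. hor_proj S c z v) (at x) w)) (at x)"
      by (rule has_derivative_transform_within_open[OF has_derivative_scaleR_right[OF hor_proj_has_derivative] open_image x])
         (simp_all add: x linear_scale[OF linear_hor_proj])
    then show ?thesis
      unfolding K_def by (rule frechet_derivative_eq)
  qed
  ultimately show ?thesis
    by (simp add: linear_iff)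
qed

lemma K_vertical [simp]: "x \<in> U \<Longrightarrow> K x (0, 0, b) = 0"
  using frechet_derivative_cong_open[OF open_image, of x "\<lambda>z. hor_proj S c z (0, 0, b)" "\<lambda>_. 0"]
  by (simp add: K_def)

lemma vert_proj_vertical [simp]: "x \<in> U \<Longrightarrow> vert_proj S c x (0, 0, b) = (0, 0, b)"
  by (simp add: vert_proj_def)

lemma vert_proj_eq: "x \<in> U \<Longrightarrow> vert_proj S c x v = (0, 0, snd (snd (vert_proj S c x v)))"
  by (simp add: vert_proj_def prod_eq_iff)

lemma linear_vert_proj: "x \<in> U \<Longrightarrow> linear (vert_proj S c x)"
  unfolding vert_proj_def[abs_def] by (intro linear_compose_sub linear_hor_proj linear_ident) 

lemma vert_proj_hor_proj [simp]: "x \<in> U \<Longrightarrow> vert_proj S c x (hor_proj S c x v) = 0"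
  by (simp add: vert_proj_def)

lemma vert_proj_K [simp]: "x \<in> U \<Longrightarrow> vert_proj S c x (K x v) = K x v"
  using vert_proj_vertical[of x "snd (snd (K x v))"] K_components[of x v] by (metis prod.collapse)

lemma hor_proj_K [simp]: "x \<in> U \<Longrightarrow> hor_proj S c x (K x v) = 0"
  using hor_proj_vertical[of x "snd (snd (K x v))"] K_components[of x v] by (metis prod.collapse)

section \<open>Jacobi endomorphism and covariant derivative of constant fields\<close>

lemma lie_bracket_hor_proj:
  "lie_bracket S (apply_endo (hor_proj S) (\<lambda>_ _. v)) c x = K x v - DS x (hor_proj S c x v)"
  by (simp add: lie_bracket_def apply_endo_const K_def)

lemma lie_bracket_vert_proj:
  assumes x: "x \<in> U"
  shows "lie_bracket S (apply_endo (vert_proj S) (\<lambda>_ _. v)) c x = - K x v - DS x (vert_proj S c x v)"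
proof -
  have "((\<lambda>z. v - hor_proj S c z v) has_derivative
      (\<lambda>w. 0 - frechet_derivative (\<lambda>z. hor_proj S c z v) (at x) w)) (at x)"
    by (intro has_derivative_diff has_derivative_const hor_proj_has_derivative x)
  from frechet_derivative_eq[OF this] show ?thesis
    by (simp add: lie_bracket_def apply_endo_const K_def vert_proj_def[abs_def])
qed

text \<open>On a constant field \<open>\<L>\<^sub>S h\<close> is
  \<open>K - DS \<circ> h + h \<circ> DS\<close>; composing with the vertical projector removes the
  last term and fixes \<open>K\<close>.\<close>

lemma jacobi_endo_eq:
  assumes x: "x \<in> U"
  shows "jacobi_endo S c x v = K x v - vert_proj S c x (DS x (hor_proj S c x v))"
  unfolding jacobi_endo_def lie_endo_def lie_bracket_hor_proj lie_bracket_const_left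
  using x by (simp add: linear_diff[OF linear_vert_proj] linear_neg[OF linear_hor_proj] linear_add[OF linear_vert_proj])

lemma linear_jacobi_endo: "x \<in> U \<Longrightarrow> linear (jacobi_endo S c x)"
  by (simp add: linear_iff jacobi_endo_eq linear_add[OF linear_K] linear_scale[OF linear_K]
      linear_add[OF linear_vert_proj] linear_scale[OF linear_vert_proj] linear_add[OF linear_DS]
      linear_scale[OF linear_DS] linear_add[OF linear_hor_proj] linear_scale[OF linear_hor_proj] scaleR_diff_right)

lemma jacobi_endo_vertical [simp]: "x \<in> U \<Longrightarrow> jacobi_endo S c x (0, 0, b) = 0"
  by (simp add: jacobi_endo_eq linear_0[OF linear_DS] linear_0[OF linear_vert_proj])

lemma jacobi_endo_components [simp]:
  assumes x: "x \<in> U"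
  shows "fst (jacobi_endo S c x v) = 0" "fst (snd (jacobi_endo S c x v)) = 0"
  unfolding jacobi_endo_def by (subst vert_proj_eq[OF x]; simp)+

text \<open>The bracket of \<open>S\<close> with a constant field is \<open>- DS v\<close>, so the
  remaining terms \<open>h \<circ> DS \<circ> v\<close> and \<open>- \<Phi>\<close> measure how
  \<open>\<nabla>\<close> differs from \<open>\<L>\<^sub>S\<close>.\<close>

lemma nabla_vfield_eq:
  assumes x: "x \<in> U"
  shows "nabla_vfield S (\<lambda>_ _. v) c x =
    hor_proj S c x (DS x (vert_proj S c x v)) - DS x v - jacobi_endo S c x v"
proof -
  have "DS x v = DS x (hor_proj S c x v) + DS x (vert_proj S c x v)"
    by (simp add: vert_proj_def linear_diff[OF linear_DS[OF x]])
  then show ?thesis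
    unfolding nabla_vfield_def lie_bracket_hor_proj lie_bracket_vert_proj[OF x] jacobi_endo_eq[OF x]
    using x by (simp add: linear_diff[OF linear_vert_proj] linear_neg[OF linear_vert_proj] linear_diff[OF linear_hor_proj])
      (simp add: vert_proj_def)
qed

section \<open>Lie and dynamical covariant derivatives of the 2-form\<close>

definition D\<omega> :: "'n jet_model \<Rightarrow> 'n jet_model \<Rightarrow> 'n jet_model \<Rightarrow> real" where
  "D\<omega> x u v = frechet_derivative (\<lambda>z. \<omega> z u v) (at x) (S c x)"

text \<open>\<open>L\<close> is \<open>\<L>\<^sub>S d\<theta>\<close> and \<open>N\<close> is \<open>\<nabla> d\<theta>\<close>.\<close>
definition L :: "'n jet_model \<Rightarrow> 'n jet_model \<Rightarrow> 'n jet_model \<Rightarrow> real" where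
  "L x u v = D\<omega> x u v + insert_endo (DS x) (\<omega> x) u v"

definition nab :: "'n jet_model \<Rightarrow> 'n jet_model \<Rightarrow> 'n jet_model" where
  "nab x v = nabla_vfield S (\<lambda>_ _. v) c x"

definition N :: "'n jet_model \<Rightarrow> 'n jet_model \<Rightarrow> 'n jet_model \<Rightarrow> real" where
  "N x u v = D\<omega> x u v - insert_endo (nab x) (\<omega> x) u v"

lemma \<omega>_has_derivative:
  "x \<in> U \<Longrightarrow> ((\<lambda>z. \<omega> z u v) has_derivative frechet_derivative (\<lambda>z. \<omega> z u v) (at x)) (at x)"
  using \<omega>_differentiable frechet_derivative_works by blast

lemma skew_D\<omega>:
  assumes x: "x \<in> U"
  shows "skew_form (D\<omega> x)"
proof (rule skew_formI)
  have swap: "D\<omega> x u v = - D\<omega> x v u" for u v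
  proof -
    have "((\<lambda>z. \<omega> z u v) has_derivative (\<lambda>w. - frechet_derivative (\<lambda>z. \<omega> z v u) (at x) w)) (at x)"
    proof (rule has_derivative_transform_within_open[OF has_derivative_minus[OF \<omega>_has_derivative] open_image x])
      show "- \<omega> z v u = \<omega> z u v" if "z \<in> U" for z
        using skew_form_swap[OF skew_\<omega>[OF that], of u v] by simp
    qed (rule x)
    then show ?thesis
      unfolding D\<omega>_def by (rule frechet_derivative_eq)
  qed
  then show "D\<omega> x u v = - D\<omega> x v u" for u v .
  have add: "D\<omega> x (u + u') v = D\<omega> x u v + D\<omega> x u' v" for u u' v
  proof -
    have "((\<lambda>z. \<omega> z (u + u') v) has_derivative (\<lambda>w. frechet_derivative (\<lambda>z. \<omega> z u v) (at x) w
        + frechet_derivative (\<lambda>z. \<omega> z u' v) (at x) w)) (at x)"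
      by (rule has_derivative_transform_within_open[OF has_derivative_add[OF \<omega>_has_derivative \<omega>_has_derivative] open_image x])
         (simp_all add: x skew_form_linear[OF skew_\<omega>])
    then show ?thesis
      unfolding D\<omega>_def by (rule frechet_derivative_eq)
  qed
  have scale: "D\<omega> x (r *\<^sub>R u) v = r *\<^sub>R D\<omega> x u v" for r u v
  proof -
    have "((\<lambda>z. \<omega> z (r *\<^sub>R u) v) has_derivative (\<lambda>w. r *\<^sub>R frechet_derivative (\<lambda>z. \<omega> z u v) (at x) w)) (at x)"
      by (rule has_derivative_transform_within_open[OF has_derivative_scaleR_right[OF \<omega>_has_derivative] open_image x])
         (simp_all add: x skew_form_linear[OF skew_\<omega>])
    then show ?thesis
      unfolding D\<omega>_def by (rule frechet_derivative_eq)
  qed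
  have "D\<omega> x u (v + v') = D\<omega> x u v + D\<omega> x u v'" for u v v'
    using swap[of u "v + v'"] swap[of u v] swap[of u v'] add[of v v' u] by simp
  moreover have "D\<omega> x u (r *\<^sub>R v) = r *\<^sub>R D\<omega> x u v" for r u v
    using swap[of u "r *\<^sub>R v"] swap[of u v] scale[of r v u] by simp
  ultimately show "bilinear (D\<omega> x)"
    using add scale by (intro bilinearI)
qed

lemma linear_nab: "x \<in> U \<Longrightarrow> linear (nab x)"
  unfolding nab_def[abs_def]
  by (simp add: nabla_vfield_eq linear_iff linear_add[OF linear_vert_proj] linear_scale[OF linear_vert_proj]
      linear_add[OF linear_DS] linear_scale[OF linear_DS] linear_add[OF linear_hor_proj]
      linear_scale[OF linear_hor_proj] linear_add[OF linear_jacobi_endo] linear_scale[OF linear_jacobi_endo]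
      scaleR_diff_right)

lemma skew_L: "x \<in> U \<Longrightarrow> skew_form (L x)"
  unfolding L_def[abs_def] by (intro skew_form_add skew_D\<omega> skew_form_insert_endo skew_\<omega> linear_DS)

lemma skew_N: "x \<in> U \<Longrightarrow> skew_form (N x)"
  unfolding N_def[abs_def] by (intro skew_form_diff skew_D\<omega> skew_form_insert_endo skew_\<omega> linear_nab)

text \<open>\<open>\<L>\<^sub>S\<close> and \<open>\<nabla>\<close> agree on functions, so on forms
  they differ only by inserting the endomorphism by which they differ on vector fields.\<close>

lemma L_eq_N:
  assumes x: "x \<in> U"
  shows "L x u v = N x u v + insert_endo (\<lambda>u. hor_proj S c x (DS x (vert_proj S c x u))) (\<omega> x) u v
    - insert_endo (jacobi_endo S c x) (\<omega> x) u v"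
  by (simp add: L_def N_def insert_endo_def nab_def nabla_vfield_eq[OF x] skew_form_linear[OF skew_\<omega>[OF x]])

lemma nabla_form_pair: "nabla_form S (ext_d \<theta>) c x [u, v] = N x u v"
  by (simp add: nabla_form_def N_def D\<omega>_def insert_endo_def nab_def \<omega>_def lessThan_Suc algebra_simps)

text \<open>The exterior derivative commutes with \<open>\<L>\<^sub>S\<close>. The left side
  contains second derivatives of \<open>\<theta>\<close> and of \<open>S\<close>; symmetry turns the
  former into \<open>D\<omega>\<close> and cancels the latter.\<close>

lemma ext_d_lie_form_pair:
  assumes x: "x \<in> U"
  shows "ext_d (lie_form S \<theta>) c x [u, v] = L x u v"
proof -
  define T where "T v p q = frechet_derivative (\<lambda>z. frechet_derivative (\<lambda>z. \<theta> c z [v]) (at z) p) (at x) q" for v p q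
  define E where "E p q = frechet_derivative (\<lambda>z. DS z p) (at x) q" for p q
  have T_sym: "T v p q = T v q p" for v p q
    unfolding T_def using \<theta>_smooth[of v]
    by (intro symmetric_second_derivative[OF open_image x]) (simp add: smooth_on_def)
  have E_sym: "E p q = E q p" for p q
    unfolding E_def using S_smooth
    by (intro symmetric_second_derivative[OF open_image x]) (simp add: smooth_on_def)
  have lie: "lie_form S \<theta> c z [v] = frechet_derivative (\<lambda>z. \<theta> c z [v]) (at z) (S c z) + \<theta> c z [DS z v]"
    if "z \<in> U" for z v
    using linear_neg[OF \<theta>_linear[OF that]] by (simp add: lie_form_def)
  have D: "frechet_derivative (\<lambda>z. lie_form S \<theta> c z [v]) (at x) u =
      T v (S c x) u + frechet_derivative (\<lambda>z. \<theta> c z [v]) (at x) (DS x u)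
      + (frechet_derivative (\<lambda>z. \<theta> c z [DS x v]) (at x) u + \<theta> c x [E v u])" for u v
  proof -
    have a: "((\<lambda>z. frechet_derivative (\<lambda>z. \<theta> c z [v]) (at z) (S c z)) has_derivative
        (\<lambda>u. T v (S c x) u + frechet_derivative (\<lambda>z. \<theta> c z [v]) (at x) (DS x u))) (at x)"
      unfolding T_def
      by (rule has_derivative_linear_apply[OF open_image x linear_D\<theta>])
         (simp_all add: S_differentiable x smooth_on_differentiable[OF smooth_on_frechet_derivative[OF \<theta>_smooth]])
    have b: "((\<lambda>z. \<theta> c z [DS z v]) has_derivative
        (\<lambda>u. frechet_derivative (\<lambda>z. \<theta> c z [DS x v]) (at x) u + \<theta> c x [E v u])) (at x)"
      unfolding E_def
      by (rule has_derivative_linear_apply[where g = "\<lambda>z w. \<theta> c z [w]", OF open_image x \<theta>_linear])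
         (simp_all add: \<theta>_differentiable x smooth_on_differentiable[OF smooth_on_frechet_derivative[OF S_smooth]])
    have "((\<lambda>z. lie_form S \<theta> c z [v]) has_derivative
      (\<lambda>u. T v (S c x) u + frechet_derivative (\<lambda>z. \<theta> c z [v]) (at x) (DS x u)
      + (frechet_derivative (\<lambda>z. \<theta> c z [DS x v]) (at x) u + \<theta> c x [E v u]))) (at x)"
      by (rule has_derivative_transform_within_open[OF has_derivative_add[OF a b] open_image x]) (simp add: lie)
    then show ?thesis
      by (rule frechet_derivative_eq)
  qed
  have "((\<lambda>z. \<omega> z u v) has_derivative (\<lambda>q. T v u q - T u v q)) (at x)"
    unfolding \<omega>_eq T_def
    by (intro has_derivative_diff)
       (simp_all add: frechet_derivative_works[symmetric] x
         smooth_on_differentiable[OF smooth_on_frechet_derivative[OF \<theta>_smooth]])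
  then have "D\<omega> x u v = T v u (S c x) - T u v (S c x)"
    unfolding D\<omega>_def by (rule frechet_derivative_eq)
  then show ?thesis
    unfolding ext_d_pair D L_def insert_endo_def \<omega>_eq
    using T_sym[of v "S c x" u] T_sym[of u "S c x" v] E_sym[of u v] by simp
qed

text \<open>\<open>\<L>\<^sub>S\<close> commutes with contraction by \<open>S\<close>: the product
  rule yields the term with \<open>DS\<close> applied to \<open>S\<close>, which is exactly the
  first-slot term in \<open>L\<close>.\<close>

lemma lie_form_interior_prod:
  assumes x: "x \<in> U"
  shows "lie_form S (interior_prod S (ext_d \<theta>)) c x [v] = L x (S c x) v"
proof -
  have "linear (\<lambda>w. \<omega> z w v)" if "z \<in> U" for z
    using that by (simp add: linear_iff skew_form_linear[OF skew_\<omega>])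
  then have "((\<lambda>z. \<omega> z (S c z) v) has_derivative
      (\<lambda>q. frechet_derivative (\<lambda>z. \<omega> z (S c x) v) (at x) q + \<omega> x (DS x q) v)) (at x)"
    by (intro has_derivative_linear_apply[where g = "\<lambda>z w. \<omega> z w v", OF open_image x])
       (simp_all add: x \<omega>_differentiable S_differentiable)
  from frechet_derivative_eq[OF this, of "S c x"] show ?thesis
    by (simp add: lie_form_def interior_prod_def \<omega>_def[symmetric] L_def D\<omega>_def insert_endo_def
        skew_form_linear[OF skew_\<omega>[OF x]])
qed

section \<open>The derivations along J, Phi and h applied to the semi-basic form\<close>

lemma ext_d_cong:
  assumes "x \<in> U" "\<And>z v. z \<in> U \<Longrightarrow> \<alpha> c z [v] = \<beta> c z [v]"
  shows "ext_d \<alpha> c x [u, v] = ext_d \<beta> c x [u, v]"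
proof -
  have "frechet_derivative (\<lambda>z. \<alpha> c z [v]) (at x) = frechet_derivative (\<lambda>z. \<beta> c z [v]) (at x)" for v
    by (rule frechet_derivative_cong_open[OF open_image assms(1)]) (rule assms(2))
  then show ?thesis
    by (simp add: ext_d_pair)
qed

text \<open>A vertical-valued \<open>B\<close> gives \<open>i_endo B \<theta> = 0\<close> on all of
  \<open>U\<close>, so only the insertion into \<open>d\<theta>\<close> remains. This covers both
  \<open>J\<close> and \<open>\<Phi>\<close>.\<close>

lemma d_endo_vertical_valued:
  assumes "x \<in> U" "\<And>z v. z \<in> U \<Longrightarrow> fst (B c z v) = 0" "\<And>z v. z \<in> U \<Longrightarrow> fst (snd (B c z v)) = 0"
  shows "d_endo B \<theta> c x [u, v] = insert_endo (B c x) (\<omega> x) u v"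
proof -
  have "\<theta> c z [B c z v] = 0" if "z \<in> U" for z v
    using \<theta>_vertical[OF that, of "snd (snd (B c z v))"] assms(2,3)[OF that, of v]
    by (metis prod.collapse)
  then have "ext_d (i_endo B \<theta>) c x [u, v] = ext_d (\<lambda>_ _ _. 0) c x [u, v]"
    by (intro ext_d_cong[OF assms(1)]) (simp add: i_endo_def)
  then show ?thesis
    by (simp add: d_endo_pair \<omega>_def[abs_def] ext_d_pair)
qed

lemma d_vert_endo_pair: "x \<in> U \<Longrightarrow> d_endo vert_endo \<theta> c x [u, v] = insert_endo (vert_endo c x) (\<omega> x) u v"
  by (rule d_endo_vertical_valued) (simp_all add: vert_endo_eq)

lemma d_jacobi_endo_pair:
  "x \<in> U \<Longrightarrow> d_endo (jacobi_endo S) \<theta> c x [u, v] = insert_endo (jacobi_endo S c x) (\<omega> x) u v"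
  by (rule d_endo_vertical_valued) simp_all

text \<open>\<open>\<theta>\<close> does not see the vertical part of a vector, so
  \<open>i_endo (hor_proj S) \<theta>\<close> is \<open>\<theta>\<close> itself and the subtracted
  term is \<open>d\<theta>\<close>.\<close>

lemma d_hor_proj_pair:
  assumes x: "x \<in> U"
  shows "d_endo (hor_proj S) \<theta> c x [u, v] = insert_endo (hor_proj S c x) (\<omega> x) u v - \<omega> x u v"
proof -
  have "\<theta> c z [hor_proj S c z v] = \<theta> c z [v]" if "z \<in> U" for z v
  proof -
    have "\<theta> c z [v] = \<theta> c z [hor_proj S c z v + vert_proj S c z v]"
      by (simp add: vert_proj_def)
    also have "\<dots> = \<theta> c z [hor_proj S c z v] + \<theta> c z [vert_proj S c z v]"
      by (rule linear_add[OF \<theta>_linear[OF that]])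
    also have "\<theta> c z [vert_proj S c z v] = 0"
      by (subst vert_proj_eq[OF that]) (rule \<theta>_vertical[OF that])
    finally show ?thesis by simp
  qed
  then have "ext_d (i_endo (hor_proj S) \<theta>) c x [u, v] = \<omega> x u v"
    unfolding \<omega>_def by (intro ext_d_cong[OF x]) (simp add: i_endo_def)
  then show ?thesis
    by (simp add: d_endo_pair \<omega>_def[abs_def])
qed

section \<open>The frame of horizontal and vertical vectors in the kernel of
  \<open>dt\<close>\<close>

definition H :: "'n jet_model \<Rightarrow> (real^'n) \<Rightarrow> 'n jet_model" where
  "H x b = hor_proj S c x (0, b, 0)"

abbreviation V :: "(real^'n) \<Rightarrow> 'n jet_model" where
  "V b \<equiv> (0, 0, b)"

lemma H_eq: "x \<in> U \<Longrightarrow> H x b = (0, b, 0) + V ((1/2) *\<^sub>R F x b)"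
  by (simp add: H_def hor_proj_eq)

lemma hor_proj_ker_dt: "x \<in> U \<Longrightarrow> fst v = 0 \<Longrightarrow> hor_proj S c x v = H x (fst (snd v))"
  by (simp add: H_def hor_proj_eq)

lemma vanishes_on_ker_dt_iff:
  assumes x: "x \<in> U" and \<beta>: "skew_form \<beta>"
  shows "vanishes_on_ker_dt \<beta> \<longleftrightarrow>
    (\<forall>a b. \<beta> (H x a) (H x b) = 0 \<and> \<beta> (H x a) (V b) = 0 \<and> \<beta> (V a) (V b) = 0)" (is "_ \<longleftrightarrow> ?R")
  unfolding vanishes_on_ker_dt_def
proof
  assume L: "\<forall>u v. fst u = 0 \<longrightarrow> fst v = 0 \<longrightarrow> \<beta> u v = 0"
  show ?R
    by (intro allI conjI L[rule_format]) (simp_all add: H_eq[OF x])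
next
  assume R: ?R
  then have VH: "\<beta> (V a) (H x b) = 0" for a b
    using skew_form_swap[OF \<beta>, of "V a" "H x b"] by simp
  show "\<forall>u v. fst u = 0 \<longrightarrow> fst v = 0 \<longrightarrow> \<beta> u v = 0"
  proof (intro allI impI)
    fix u v :: "'n jet_model"
    assume "fst u = 0" "fst v = 0"
    \<comment> \<open>The \<open>x\<close>-component fixes the horizontal part; the
      \<open>y\<close>-component is corrected by the \<open>F / 2\<close> that the horizontal lift
      brings along.\<close>
    then have "u = H x (fst (snd u)) + V (snd (snd u) - (1/2) *\<^sub>R F x (fst (snd u)))"
      "v = H x (fst (snd v)) + V (snd (snd v) - (1/2) *\<^sub>R F x (fst (snd v)))"
      by (simp_all add: H_eq[OF x] prod_eq_iff)
    then obtain a a' b b' where "u = H x a + V a'" "v = H x b + V b'"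
      by blast
    then show "\<beta> u v = 0"
      using R VH by (simp add: skew_form_linear[OF \<beta>])
  qed
qed

text \<open>The mixed block of \<open>d\<theta>\<close> in the frame. Since \<open>d\<theta>\<close>
  vanishes on vertical pairs, \<open>(0, a, 0)\<close> may replace \<open>H x a\<close>, so both
  arguments stay constant when the point is differentiated.\<close>

definition \<A> :: "'n jet_model \<Rightarrow> (real^'n) \<Rightarrow> (real^'n) \<Rightarrow> real" where
  "\<A> x a b = \<omega> x (0, a, 0) (V b)"

lemma \<omega>_HV:
  assumes x: "x \<in> U"
  shows "\<omega> x (H x a) (V b) = \<A> x a b" "\<omega> x (V b) (H x a) = - \<A> x a b"
proof -
  show 1: "\<omega> x (H x a) (V b) = \<A> x a b"
    using \<omega>_vertical[OF x, of "(1/2) *\<^sub>R F x a" b]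
    unfolding H_eq[OF x] skew_form_linear[OF skew_\<omega>[OF x]] by (simp add: \<A>_def)
  then show "\<omega> x (V b) (H x a) = - \<A> x a b"
    using skew_form_swap[OF skew_\<omega>[OF x], of "V b" "H x a"] by simp
qed

lemma \<A>_scale:
  assumes x: "x \<in> U"
  shows "\<A> x (r *\<^sub>R a) b = r * \<A> x a b" "\<A> x a (r *\<^sub>R b) = r * \<A> x a b"
  unfolding \<A>_def
  using skew_form_linear(2)[OF skew_\<omega>[OF x], where r = r and u = "(0, a, 0)" and v = "V b"]
    skew_form_linear(7)[OF skew_\<omega>[OF x], where r = r and u = "(0, a, 0)" and v = "V b"]
  by simp_all

lemma \<omega>_vertical_components:
  assumes "x \<in> U" "fst u = 0" "fst (snd u) = 0"
  shows "\<omega> x u (V b) = 0" "\<omega> x (V b) u = 0"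
proof -
  have "u = V (snd (snd u))"
    using assms(2,3) by (simp add: prod_eq_iff)
  then show "\<omega> x u (V b) = 0" "\<omega> x (V b) u = 0"
    using \<omega>_vertical[OF assms(1)] by metis+
qed

section \<open>Values of the two derivatives on the frame\<close>

lemma hor_DS_vert_H [simp]: "x \<in> U \<Longrightarrow> hor_proj S c x (DS x (vert_proj S c x (H x a))) = 0"
  by (simp add: H_def linear_0[OF linear_DS] linear_0[OF linear_hor_proj])

text \<open>\<open>DS\<close> sends \<open>V a\<close> to \<open>(0, a, F a)\<close>, whose
  horizontal part is \<open>H a\<close>. This replacement of vertical by horizontal vectors produces
  the extra terms in \<open>L_HV\<close> and \<open>L_VV\<close>.\<close>

lemma hor_DS_vertical [simp]: "x \<in> U \<Longrightarrow> hor_proj S c x (DS x (V a)) = H x a"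
  by (simp add: hor_proj_ker_dt DS_components)

lemma nab_vertical:
  assumes x: "x \<in> U"
  shows "nab x (V a) = V (- (1/2) *\<^sub>R F x a)"
  unfolding nab_def nabla_vfield_eq[OF x] vert_proj_vertical[OF x] hor_DS_vertical[OF x]
  unfolding jacobi_endo_vertical[OF x] DS_vertical[OF x] H_eq[OF x]
  by (simp add: vec_eq_iff)

text \<open>\<open>\<nabla>\<close> maps constant vertical fields to vertical vectors, and
  \<open>d\<theta>\<close> vanishes on vertical pairs throughout \<open>U\<close>.\<close>

lemma N_VV:
  assumes x: "x \<in> U"
  shows "N x (V a) (V b) = 0"
proof -
  have "D\<omega> x (V a) (V b) = 0"
    unfolding D\<omega>_def
    using frechet_derivative_cong_open[OF open_image x, of "\<lambda>z. \<omega> z (V a) (V b)" "\<lambda>_. 0"]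
    by (simp add: \<omega>_vertical)
  then show ?thesis
    by (simp add: N_def insert_endo_def nab_vertical[OF x] \<omega>_vertical[OF x])
qed

lemma L_HH:
  assumes x: "x \<in> U"
  shows "L x (H x a) (H x b) = N x (H x a) (H x b) - insert_endo (jacobi_endo S c x) (\<omega> x) (H x a) (H x b)"
  unfolding L_eq_N[OF x] insert_endo_def using x by (simp add: skew_form_linear[OF skew_\<omega>[OF x]])

text \<open>The correction turns \<open>V b\<close> into \<open>H b\<close>; the terms with
  \<open>\<Phi>\<close> drop out because it is vertical-valued and kills \<open>V b\<close>.\<close>

lemma L_HV:
  assumes x: "x \<in> U"
  shows "L x (H x a) (V b) = N x (H x a) (V b) + \<omega> x (H x a) (H x b)"
  unfolding L_eq_N[OF x] insert_endo_def
  using x by (simp add: skew_form_linear[OF skew_\<omega>[OF x]] \<omega>_vertical_components)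

lemma L_VV:
  assumes x: "x \<in> U"
  shows "L x (V a) (V b) = \<A> x a b - \<A> x b a"
  unfolding L_eq_N[OF x] insert_endo_def
  using x by (simp add: skew_form_linear[OF skew_\<omega>[OF x]] N_VV \<omega>_HV)

text \<open>Both slots of \<open>\<A>\<close> receive the same connection term \<open>F / 2\<close>,
  which is why \<open>\<nabla>\<close> preserves the symmetry of \<open>\<A>\<close>.\<close>

lemma N_HV:
  assumes x: "x \<in> U"
  shows "N x (H x a) (V b) =
    frechet_derivative (\<lambda>z. \<A> z a b) (at x) (S c x) + (1/2) * \<A> x (F x a) b + (1/2) * \<A> x a (F x b)"
proof -
  note lin = skew_form_linear[OF skew_\<omega>[OF x]]
  have vert: "vert_proj S c x (0, a, 0) = V (- (1/2) *\<^sub>R F x a)"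
    by (simp add: vert_proj_def hor_proj_eq[OF x])
  have nab: "nab x (0, a, 0) = H x (- (1/2) *\<^sub>R F x a) - DS x (0, a, 0) - jacobi_endo S c x (0, a, 0)"
    unfolding nab_def nabla_vfield_eq[OF x] vert using x by simp
  have "\<omega> x (nab x (0, a, 0)) (V b) = - (1/2) * \<A> x (F x a) b"
    unfolding nab lin(4) \<omega>_HV[OF x] \<A>_scale[OF x]
    \<comment> \<open>\<open>DS (0, a, 0)\<close> has no \<open>x\<close>-component, so it is
      vertical like the value of \<open>\<Phi>\<close>, and neither pairs with
      \<open>V b\<close>.\<close>
    using x by (simp add: \<omega>_vertical_components DS_components)
  moreover have "\<omega> x (0, a, 0) (nab x (V b)) = - (1/2) * \<A> x a (F x b)"
    unfolding nab_vertical[OF x] \<A>_def[symmetric] \<A>_scale[OF x] by simp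
  moreover have "N x (H x a) (V b) = N x (0, a, 0) (V b)"
    unfolding H_eq[OF x] skew_form_linear[OF skew_N[OF x]] by (simp add: N_VV[OF x])
  ultimately show ?thesis
    by (simp add: N_def insert_endo_def D\<omega>_def \<A>_def)
qed

lemma N_HV_symmetric:
  assumes x: "x \<in> U" and sym: "\<And>z a b. z \<in> U \<Longrightarrow> \<A> z a b = \<A> z b a"
  shows "N x (H x a) (V b) = N x (H x b) (V a)"
proof -
  have "frechet_derivative (\<lambda>z. \<A> z a b) (at x) = frechet_derivative (\<lambda>z. \<A> z b a) (at x)"
    by (rule frechet_derivative_cong_open[OF open_image x sym])
  then show ?thesis
    unfolding N_HV[OF x] using sym[OF x, of "F x a" b] sym[OF x, of a "F x b"] by simp
qed

text \<open>Differentiate the identity \<open>\<omega>(H a, H b) = 0\<close> along \<open>S\<close>.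
  The derivatives of the moving frame are the \<open>K\<close> terms, which cancel those in
  \<open>\<nabla> H\<close>; what is left of \<open>\<nabla> H\<close> is horizontal and pairs to
  zero.\<close>

lemma N_HH:
  assumes x: "x \<in> U" and zero: "\<And>z a b. z \<in> U \<Longrightarrow> \<omega> z (H z a) (H z b) = 0"
  shows "N x (H x a) (H x b) = 0"
proof -
  note lin = skew_form_linear[OF skew_\<omega>[OF x]]
  have Hdiff: "(\<lambda>z. H z b) differentiable (at x)" for b
    unfolding H_def by (rule differentiableI[OF hor_proj_has_derivative[OF x]])
  have K: "frechet_derivative (\<lambda>z. H z b) (at x) (S c x) = K x (0, b, 0)" for b
    by (simp add: H_def K_def)
  have lin_r: "linear (\<omega> z u)" and lin_l: "linear (\<lambda>w. \<omega> z w v)" if "z \<in> U" for z u v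
    using that by (simp_all add: linear_iff skew_form_linear[OF skew_\<omega>])
  have 1: "((\<lambda>z. \<omega> z u (H z b)) has_derivative
      (\<lambda>q. frechet_derivative (\<lambda>z. \<omega> z u (H x b)) (at x) q + \<omega> x u (frechet_derivative (\<lambda>z. H z b) (at x) q))) (at x)"
    for u
    by (rule has_derivative_linear_apply[where g = "\<lambda>z w. \<omega> z u w", OF open_image x lin_r])
       (simp_all add: \<omega>_differentiable x Hdiff)
  \<comment> \<open>The product rule is applied one slot at a time: the first step froze the left
    argument, this one lets it move as well.\<close>
  have 2: "((\<lambda>z. \<omega> z (H z a) (H z b)) has_derivative
      (\<lambda>q. frechet_derivative (\<lambda>z. \<omega> z (H x a) (H z b)) (at x) q
        + \<omega> x (frechet_derivative (\<lambda>z. H z a) (at x) q) (H x b))) (at x)"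
    by (rule has_derivative_linear_apply[where g = "\<lambda>z w. \<omega> z w (H z b)", OF open_image x lin_l])
       (simp_all add: differentiableI[OF 1] Hdiff)
  have "frechet_derivative (\<lambda>z. \<omega> z (H z a) (H z b)) (at x) = (\<lambda>_. 0)"
    using frechet_derivative_cong_open[OF open_image x, of "\<lambda>z. \<omega> z (H z a) (H z b)" "\<lambda>_. 0"]
    by (simp add: zero)
  then have D: "D\<omega> x (H x a) (H x b) = - \<omega> x (H x a) (K x (0, b, 0)) - \<omega> x (K x (0, a, 0)) (H x b)"
    using frechet_derivative_eq[OF 2, of "S c x"] frechet_derivative_eq[OF 1, of "H x a" "S c x"]
    by (simp add: K D\<omega>_def)
  have nabH: "nab x (H x a) = - K x (0, a, 0) - H x ((1/2) *\<^sub>R F x a)" for a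
  proof -
    have "K x (H x a) = K x (0, a, 0)"
      unfolding H_eq[OF x] linear_add[OF linear_K[OF x]] K_vertical[OF x] by simp
    moreover have "hor_proj S c x (DS x (H x a)) = H x ((1/2) *\<^sub>R F x a)"
      using x by (simp add: hor_proj_ker_dt DS_components H_eq)
    moreover have "DS x (H x a) = hor_proj S c x (DS x (H x a)) + vert_proj S c x (DS x (H x a))"
      by (simp add: vert_proj_def)
    moreover have "hor_proj S c x (H x a) = H x a"
      using x by (simp add: H_def)
    ultimately show ?thesis
      unfolding nab_def nabla_vfield_eq[OF x] jacobi_endo_eq[OF x] using x
      by (simp add: algebra_simps)
  qed
  show ?thesis
    unfolding N_def insert_endo_def nabH D lin by (simp add: zero[OF x])
qed

section \<open>The conditions (H1) to (H4) in the frame\<close>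

lemma vert_endo_ker_dt: "fst v = 0 \<Longrightarrow> vert_endo c x v = V (fst (snd v))"
  by (simp add: vert_endo_eq)

lemma fst_H [simp]: "x \<in> U \<Longrightarrow> fst (H x a) = 0" "x \<in> U \<Longrightarrow> fst (snd (H x a)) = a"
  by (simp_all add: H_eq)

lemma linear_vert_endo: "linear (vert_endo c x)"
  by (simp add: linear_iff vert_endo_eq algebra_simps)

text \<open>\<open>J\<close> sends \<open>H a\<close> to \<open>V a\<close> and kills
  \<open>V a\<close>, so only the horizontal block survives, as the skew part of
  \<open>\<A>\<close>.\<close>

lemma H1_iff:
  assumes x: "x \<in> U"
  shows "vanishes_on_ker_dt (insert_endo (vert_endo c x) (\<omega> x)) \<longleftrightarrow> (\<forall>a b. \<A> x a b = \<A> x b a)"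
proof -
  note lin = skew_form_linear[OF skew_\<omega>[OF x]]
  have "insert_endo (vert_endo c x) (\<omega> x) (H x a) (H x b) = \<A> x a b - \<A> x b a" for a b
    using x by (simp add: insert_endo_def vert_endo_ker_dt \<omega>_HV)
  moreover have "insert_endo (vert_endo c x) (\<omega> x) (H x a) (V b) = 0"
      "insert_endo (vert_endo c x) (\<omega> x) (V a) (V b) = 0" for a b
    using x by (simp_all add: insert_endo_def vert_endo_ker_dt \<omega>_vertical lin flip: zero_prod_def)
  ultimately show ?thesis
    unfolding vanishes_on_ker_dt_iff[OF x skew_form_insert_endo[OF skew_\<omega>[OF x] linear_vert_endo]]
    by simp
qed

text \<open>Inserting \<open>h\<close> counts horizontal slots: after subtracting
  \<open>d\<theta>\<close>, a horizontal pair keeps factor \<open>2 - 1\<close>, a mixed pair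
  \<open>1 - 1\<close>, and vertical pairs vanish anyway.\<close>

lemma H2_iff:
  assumes x: "x \<in> U"
  shows "vanishes_on_ker_dt (\<lambda>u v. insert_endo (hor_proj S c x) (\<omega> x) u v - \<omega> x u v) \<longleftrightarrow>
    (\<forall>a b. \<omega> x (H x a) (H x b) = 0)"
proof -
  have "hor_proj S c x (H x a) = H x a" for a
    using x by (simp add: H_def)
  then show ?thesis
    unfolding vanishes_on_ker_dt_iff[OF x skew_form_diff[OF
        skew_form_insert_endo[OF skew_\<omega>[OF x] linear_hor_proj[OF x]] skew_\<omega>[OF x]]]
    using x by (simp add: insert_endo_def skew_form_linear[OF skew_\<omega>[OF x]] \<omega>_vertical)
qed

text \<open>\<open>\<Phi>\<close> is vertical-valued and kills vertical vectors, so mixed and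
  vertical pairs contribute nothing.\<close>

lemma H3_iff:
  assumes x: "x \<in> U"
  shows "vanishes_on_ker_dt (insert_endo (jacobi_endo S c x) (\<omega> x)) \<longleftrightarrow>
    (\<forall>a b. insert_endo (jacobi_endo S c x) (\<omega> x) (H x a) (H x b) = 0)"
proof -
  have "insert_endo (jacobi_endo S c x) (\<omega> x) (H x a) (V b) = 0"
      "insert_endo (jacobi_endo S c x) (\<omega> x) (V a) (V b) = 0" for a b
    using x by (simp_all add: insert_endo_def \<omega>_vertical_components skew_form_linear[OF skew_\<omega>[OF x]])
  then show ?thesis
    unfolding vanishes_on_ker_dt_iff[OF x skew_form_insert_endo[OF skew_\<omega>[OF x] linear_jacobi_endo[OF x]]]
    by simp
qed

lemma H4_iff:
  assumes x: "x \<in> U"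
  shows "vanishes_on_ker_dt (N x) \<longleftrightarrow> (\<forall>a b. N x (H x a) (H x b) = 0 \<and> N x (H x a) (V b) = 0)"
  unfolding vanishes_on_ker_dt_iff[OF x skew_N[OF x]] by (simp add: N_VV[OF x])

section \<open>The equivalence in one chart\<close>

lemma L_eq_0_iff:
  assumes x: "x \<in> U"
  shows "(\<forall>u v. L x u v = 0) \<longleftrightarrow>
    (\<forall>a b. L x (H x a) (H x b) = 0 \<and> L x (H x a) (V b) = 0 \<and> L x (V a) (V b) = 0) \<and>
    (\<forall>v. L x (S c x) v = 0)" (is "?lhs \<longleftrightarrow> ?ker \<and> ?S")
proof (intro iffI)
  assume "?ker \<and> ?S"
  then have ker: "\<And>u v. fst u = 0 \<Longrightarrow> fst v = 0 \<Longrightarrow> L x u v = 0" and S: "\<And>v. L x (S c x) v = 0"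
    unfolding vanishes_on_ker_dt_iff[OF x skew_L[OF x], symmetric] vanishes_on_ker_dt_def by auto
  show ?lhs
  proof (intro allI)
    fix u v
    \<comment> \<open>As \<open>dt\<close> of \<open>S\<close> is 1, subtracting these multiples of
      \<open>S\<close> projects both arguments to the kernel of \<open>dt\<close>.\<close>
    have "L x (u - fst u *\<^sub>R S c x) (v - fst v *\<^sub>R S c x) = 0"
      by (rule ker) (simp_all add: S_components[OF x])
    moreover have "L x u (S c x) = 0"
      using S[of u] skew_form_swap[OF skew_L[OF x], of u "S c x"] by simp
    ultimately show "L x u v = 0"
      by (simp add: skew_form_linear[OF skew_L[OF x]] S)
  qed
qed blast

text \<open>All conditions are quantified over the whole of \<open>U\<close>: the forward direction
  differentiates the symmetry of \<open>\<A>\<close> and the vanishing of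
  \<open>\<omega>(H a, H b)\<close>, for which a single point would not do.\<close>

lemma L_vanishes_iff:
  "(\<forall>x\<in>U. \<forall>u v. L x u v = 0) \<longleftrightarrow>
    (\<forall>x\<in>U. vanishes_on_ker_dt (insert_endo (vert_endo c x) (\<omega> x))) \<and>
    (\<forall>x\<in>U. vanishes_on_ker_dt (\<lambda>u v. insert_endo (hor_proj S c x) (\<omega> x) u v - \<omega> x u v)) \<and>
    (\<forall>x\<in>U. vanishes_on_ker_dt (insert_endo (jacobi_endo S c x) (\<omega> x))) \<and>
    (\<forall>x\<in>U. vanishes_on_ker_dt (N x)) \<and>
    (\<forall>x\<in>U. \<forall>v. L x (S c x) v = 0)" (is "?L \<longleftrightarrow> ?H1 \<and> ?H2 \<and> ?H3 \<and> ?H4 \<and> ?DS")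
proof
  assume L: ?L
  have sym: "\<A> x a b = \<A> x b a" if "x \<in> U" for x a b
    using L_VV[OF that, of a b] L[rule_format, OF that] by simp
  have HV: "N x (H x a) (V b) = 0 \<and> \<omega> x (H x a) (H x b) = 0" if x: "x \<in> U" for x a b
  proof -
    \<comment> \<open>The same equation for \<open>(a, b)\<close> and \<open>(b, a)\<close>: its
      first term is symmetric and its second skew, so each vanishes.\<close>
    have "N x (H x a) (V b) + \<omega> x (H x a) (H x b) = 0" "N x (H x b) (V a) + \<omega> x (H x b) (H x a) = 0"
      using L L_HV[OF x] x by metis+
    moreover have "\<omega> x (H x b) (H x a) = - \<omega> x (H x a) (H x b)"
      by (rule skew_form_swap[OF skew_\<omega>[OF x]])
    moreover have "N x (H x a) (V b) = N x (H x b) (V a)"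
      by (rule N_HV_symmetric[OF x sym])
    ultimately show ?thesis by linarith
  qed
  have HH: "N x (H x a) (H x b) = 0" if x: "x \<in> U" for x a b
    by (rule N_HH[OF x]) (simp add: HV)
  have "insert_endo (jacobi_endo S c x) (\<omega> x) (H x a) (H x b) = 0" if x: "x \<in> U" for x a b
    using L_HH[OF x, of a b] HH[OF x, of a b] L[rule_format, OF x] by simp
  moreover have ?DS
    using L by blast
  ultimately show "?H1 \<and> ?H2 \<and> ?H3 \<and> ?H4 \<and> ?DS"
    using sym HV HH by (simp add: H1_iff H2_iff H3_iff H4_iff)
next
  assume R: "?H1 \<and> ?H2 \<and> ?H3 \<and> ?H4 \<and> ?DS"
  show ?L
  proof (intro ballI)
    fix x assume x: "x \<in> U"
    have "vanishes_on_ker_dt (insert_endo (vert_endo c x) (\<omega> x))"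
      "vanishes_on_ker_dt (\<lambda>u v. insert_endo (hor_proj S c x) (\<omega> x) u v - \<omega> x u v)"
      "vanishes_on_ker_dt (insert_endo (jacobi_endo S c x) (\<omega> x))"
      "vanishes_on_ker_dt (N x)" "\<forall>v. L x (S c x) v = 0"
      using R x by blast+
    then have "\<forall>a b. \<A> x a b = \<A> x b a" "\<forall>a b. \<omega> x (H x a) (H x b) = 0"
      "\<forall>a b. insert_endo (jacobi_endo S c x) (\<omega> x) (H x a) (H x b) = 0"
      "\<forall>a b. N x (H x a) (H x b) = 0 \<and> N x (H x a) (V b) = 0" "\<forall>v. L x (S c x) v = 0"
      unfolding H1_iff[OF x] H2_iff[OF x] H3_iff[OF x] H4_iff[OF x] .
    \<comment> \<open>The converse is pointwise: every block of \<open>L\<close>, and its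
      contraction with \<open>S\<close>, is a combination of quantities that are now zero.\<close>
    then show "\<forall>u v. L x u v = 0"
      unfolding L_eq_0_iff[OF x] L_HH[OF x] L_HV[OF x] L_VV[OF x] by simp
  qed
qed

lemma lie_form_closed_iff:
  "(\<forall>x\<in>U. \<forall>vs. length vs = 2 \<longrightarrow> ext_d (lie_form S \<theta>) c x vs = 0) \<longleftrightarrow>
    (\<forall>x\<in>U. \<forall>vs. length vs = 3 \<longrightarrow> wedge1 (d_endo vert_endo \<theta>) dt c x vs = 0) \<and>
    (\<forall>x\<in>U. \<forall>vs. length vs = 3 \<longrightarrow> wedge1 (d_endo (hor_proj S) \<theta>) dt c x vs = 0) \<and>
    (\<forall>x\<in>U. \<forall>vs. length vs = 3 \<longrightarrow> wedge1 (d_endo (jacobi_endo S) \<theta>) dt c x vs = 0) \<and>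
    (\<forall>x\<in>U. \<forall>vs. length vs = 3 \<longrightarrow> wedge1 (nabla_form S (ext_d \<theta>)) dt c x vs = 0) \<and>
    (\<forall>x\<in>U. \<forall>vs. length vs = 1 \<longrightarrow> lie_form S (interior_prod S (ext_d \<theta>)) c x vs = 0)"
proof -
  have pairs: "(\<forall>vs. length vs = 2 \<longrightarrow> P vs) \<longleftrightarrow> (\<forall>u v. P [u, v])" for P :: "'n jet_model list \<Rightarrow> bool"
    by (auto simp: numeral_2_eq_2 length_Suc_conv)
  have singletons: "(\<forall>vs. length vs = 1 \<longrightarrow> P vs) \<longleftrightarrow> (\<forall>v. P [v])" for P :: "'n jet_model list \<Rightarrow> bool"
    by (auto simp: length_Suc_conv)
  note skew = skew_form_insert_endo[OF skew_\<omega>]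
  have J: "(\<forall>vs. length vs = 3 \<longrightarrow> wedge1 (d_endo vert_endo \<theta>) dt c x vs = 0) \<longleftrightarrow>
        vanishes_on_ker_dt (insert_endo (vert_endo c x) (\<omega> x))" if x: "x \<in> U" for x
    using skew[OF x linear_vert_endo] d_vert_endo_pair[OF x] by (rule wedge1_dt_eq_0_iff)
  have h: "(\<forall>vs. length vs = 3 \<longrightarrow> wedge1 (d_endo (hor_proj S) \<theta>) dt c x vs = 0) \<longleftrightarrow>
        vanishes_on_ker_dt (\<lambda>u v. insert_endo (hor_proj S c x) (\<omega> x) u v - \<omega> x u v)" if x: "x \<in> U" for x
    using skew_form_diff[OF skew[OF x linear_hor_proj[OF x]] skew_\<omega>[OF x]] d_hor_proj_pair[OF x]
    by (rule wedge1_dt_eq_0_iff)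
  have \<Phi>: "(\<forall>vs. length vs = 3 \<longrightarrow> wedge1 (d_endo (jacobi_endo S) \<theta>) dt c x vs = 0) \<longleftrightarrow>
        vanishes_on_ker_dt (insert_endo (jacobi_endo S c x) (\<omega> x))" if x: "x \<in> U" for x
    using skew[OF x linear_jacobi_endo[OF x]] d_jacobi_endo_pair[OF x] by (rule wedge1_dt_eq_0_iff)
  have n: "(\<forall>vs. length vs = 3 \<longrightarrow> wedge1 (nabla_form S (ext_d \<theta>)) dt c x vs = 0) \<longleftrightarrow>
        vanishes_on_ker_dt (N x)" if x: "x \<in> U" for x
    using skew_N[OF x] nabla_form_pair by (rule wedge1_dt_eq_0_iff)
  have DS: "(\<forall>vs. length vs = 1 \<longrightarrow> lie_form S (interior_prod S (ext_d \<theta>)) c x vs = 0) \<longleftrightarrow>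
        (\<forall>v. L x (S c x) v = 0)" if x: "x \<in> U" for x
    unfolding singletons lie_form_interior_prod[OF x] ..
  have closed: "(\<forall>vs. length vs = 2 \<longrightarrow> ext_d (lie_form S \<theta>) c x vs = 0) \<longleftrightarrow> (\<forall>u v. L x u v = 0)"
    if x: "x \<in> U" for x
    unfolding pairs ext_d_lie_form_pair[OF x] ..
  show ?thesis
    using L_vanishes_iff by (simp only: J h \<Phi> n DS closed cong: ball_cong)
qed

end

section \<open>From single charts to the jet bundle\<close>

theorem theorem5p2:
  fixes T :: "'a topology"
    and A :: "('a, real \<times> (real^'n)) chart set"
    and \<pi> :: "'a \<Rightarrow> real"
    and S :: "('a jet, 'n jet_model) vfield"
    and \<theta> :: "('a jet, 'n jet_model) form"
  assumes "fibred_manifold T A \<pi>"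
    and "semispray A \<pi> S"
    and "semi_basic_1form A \<pi> \<theta>"
    and "\<not> form_eq_0 (jet_atlas A \<pi>) 2 (d_endo vert_endo \<theta>)"
  shows "form_eq_0 (jet_atlas A \<pi>) 2 (ext_d (lie_form S \<theta>)) \<longleftrightarrow>
      form_eq_0 (jet_atlas A \<pi>) 3 (wedge1 (d_endo vert_endo \<theta>) dt) \<and>
      form_eq_0 (jet_atlas A \<pi>) 3 (wedge1 (d_endo (hor_proj S) \<theta>) dt) \<and>
      form_eq_0 (jet_atlas A \<pi>) 3 (wedge1 (d_endo (jacobi_endo S) \<theta>) dt) \<and>
      form_eq_0 (jet_atlas A \<pi>) 3 (wedge1 (nabla_form S (ext_d \<theta>)) dt) \<and>
      form_eq_0 (jet_atlas A \<pi>) 1 (lie_form S (interior_prod S (ext_d \<theta>)))"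
proof -
  have M: "smooth_manifold T A"
    using assms(1) by (simp add: fibred_manifold_def)
  have "jet_patch c S \<theta>" if c: "c \<in> jet_atlas A \<pi>" for c
  proof (rule jet_patch.intro)
    show "open (chart_image c)"
      by (rule open_jet_chart_image[OF M c])
    show "smooth_on (chart_image c) (S c)"
      using assms(2) c by (simp add: semispray_def vector_field_def)
    show "vert_endo c x (S c x) = 0" "dt c x [S c x] = 1" if "x \<in> chart_image c" for x
      using assms(2) c that unfolding semispray_def by blast+
    have \<theta>: "smooth_on (chart_image c) (\<lambda>x. \<theta> c x vs)"
      "\<And>x i. x \<in> chart_image c \<Longrightarrow> i < 1 \<Longrightarrow> linear (\<lambda>v. \<theta> c x (vs[i := v]))" if "length vs = 1" for vs
      using assms(3) c that unfolding semi_basic_1form_def diff_form_def by blast+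
    show "smooth_on (chart_image c) (\<lambda>x. \<theta> c x [v])" for v
      using \<theta>(1)[of "[v]"] by simp
    show "linear (\<lambda>v. \<theta> c x [v])" if "x \<in> chart_image c" for x
      \<comment> \<open>The entry 0 is a placeholder in a list of length one; the update at index 0
        overwrites it.\<close>
      using \<theta>(2)[of "[0]" x 0] that by simp
    show "\<theta> c x [(0, 0, b)] = 0" if "x \<in> chart_image c" for x b
      using assms(3) c that vertical_fibre_direction[OF M c that] unfolding semi_basic_1form_def by blast
  qed
  note local_equivalence = jet_patch.lie_form_closed_iff[OF this]
  show ?thesis
    unfolding form_eq_0_def
    \<comment> \<open>Vanishing of a form means vanishing in every chart, so the chartwise
      equivalences combine once the quantifier over charts is distributed over the
      conjunction.\<close>
    by (simp only: local_equivalence ball_conj_distrib cong: ball_cong)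
qed

end
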